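(* Let $X$ be an irreducible continuous-time Markov process on a finite set $\mathcal{X}$ with kernel $p$, reversible with respect to the probability measure $\mu$, and let $\mathcal{R}\subset\mathcal{X}$ be such that the restricted processes $X_{\mathcal{R}}$ and $X_{\mathcal{X}\setminus\mathcal{R}}$ are irreducible. If $\varepsilon^*_{\mathcal{R}}<1/3$, then for all $x,y\in\mathcal{R}$ and $\delta\in(0,1)$, $$\left|\frac{\mathbb{P}_x(X(t)=y\mid\tau_{\mathcal{X}\setminus\mathcal{R}}>t)}{\mu^*_{\mathcal{R}}(y)}-1\right|<\delta\quad\text{as soon as}\quad t>T^*_{\delta,\mathcal{R}}.$$
   Context: $X$ has generator $\mathcal{L}f(x)=\sum_{y\in\mathcal{X}}p(x,y)(f(y)-f(x))$ with $p\ge0$, $\sum_yp(x,y)=1$, $\mu(x)p(x,y)=\mu(y)p(y,x)$. $\mathcal{R}$ is a nonempty proper subset with at least two elements; $\tau_{\mathcal{X}\setminus\mathcal{R}}$ is the hitting time of $\mathcal{X}\setminus\mathcal{R}$. The restricted process $X_{\mathcal{R}}$ on $\mathcal{R}$ has kernel $p_{\mathcal{R}}(x,y)=p(x,y)$ for $x\ne y$, $p_{\mathcal{R}}(x,x)=p(x,x)+\sum_{y\notin\mathcal{R}}p(x,y)$ (similarly for $\mathcal{X}\setminus\mathcal{R}$); it is reversible with respect to $\mu_{\mathcal{R}}=\mu(\cdot\mid\mathcal{R})$, with spectral gap $\gamma_{\mathcal{R}}=\min_{\mathrm{Var}_{\mu_{\mathcal{R}}}(f)\ne0}\mathcal{D}_{\mathcal{R}}(f)/\mathrm{Var}_{\mu_{\mathcal{R}}}(f)$,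 $\mathcal{D}_{\mathcal{R}}(f)=\frac12\sum_{x,y\in\mathcal{R}}\mu_{\mathcal{R}}(x)p_{\mathcal{R}}(x,y)(f(x)-f(y))^2$. Let $p^*_{\mathcal{R}}(x,y)=p(x,y)$, $x,y\in\mathcal{R}$; $1-\phi^*_{\mathcal{R}}$ is its spectral radius, and $\mu^*_{\mathcal{R}}$ the unique probability measure on $\mathcal{R}$ with $\mu^*_{\mathcal{R}}p^*_{\mathcal{R}}=(1-\phi^*_{\mathcal{R}})\mu^*_{\mathcal{R}}$ (quasi-stationary measure). Set $\varepsilon^*_{\mathcal{R}}=\phi^*_{\mathcal{R}}/\gamma_{\mathcal{R}}$, $h^*_{\mathcal{R}}(x)=\mu^*_{\mathcal{R}}(x)/\mu_{\mathcal{R}}(x)$, $\zeta^*_{\mathcal{R}}=\min_{x\in\mathcal{R}}\mu_{\mathcal{R}}(x)h^*_{\mathcal{R}}(x)^2$ and, for $\delta\in(0,1)$ and $\varepsilon^*_{\mathcal{R}}<1/3$, $$T^*_{\delta,\mathcal{R}}=\frac{1}{\gamma_{\mathcal{R}}}\left(\ln\frac{2}{\delta(1-\delta)\zeta^*_{\mathcal{R}}}\right)\left(1+\sqrt{\frac{\varepsilon^*_{\mathcal{R}}}{1-\varepsilon^*_{\mathcal{R}}}}\right)\left(\frac{1-\varepsilon^*_{\mathcal{R}}}{1-3\varepsilon^*_{\mathcal{R}}}\right).$$ *)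

theory Defs
  imports "HOL-Probability.Probability"
begin

section \<open>Kernels on a finite state space\<close>

definition stochastic_kernel :: "('a::finite \<Rightarrow> 'a \<Rightarrow> real) \<Rightarrow> bool" where
  "stochastic_kernel p \<longleftrightarrow> (\<forall>x y. 0 \<le> p x y) \<and> (\<forall>x. (\<Sum>y\<in>UNIV. p x y) = 1)"

definition reversible :: "('a \<Rightarrow> 'a \<Rightarrow> real) \<Rightarrow> 'a pmf \<Rightarrow> bool" where
  "reversible p \<mu> \<longleftrightarrow> (\<forall>x y. pmf \<mu> x * p x y = pmf \<mu> y * p y x)"

text \<open>Irreducibility on \<open>S\<close>: any two states of \<open>S\<close> communicate through paths that stay in \<open>S\<close>
  and have positive jump rates.\<close>

definition irreducible_on :: "'a set \<Rightarrow> ('a \<Rightarrow> 'a \<Rightarrow> real) \<Rightarrow> bool" where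
  "irreducible_on S p \<longleftrightarrow>
    (\<forall>x\<in>S. \<forall>y\<in>S. (x, y) \<in> {(u, v). u \<in> S \<and> v \<in> S \<and> p u v > 0}\<^sup>*)"

text \<open>Only the values on \<open>S \<times> S\<close> are meaningful.\<close>

definition restricted_kernel :: "('a::finite \<Rightarrow> 'a \<Rightarrow> real) \<Rightarrow> 'a set \<Rightarrow> 'a \<Rightarrow> 'a \<Rightarrow> real" where
  "restricted_kernel p S x y = (if x = y then p x x + (\<Sum>z\<in>- S. p x z) else p x y)"

section \<open>Continuous-time Markov processes\<close>

definition generator :: "('a::finite \<Rightarrow> 'a \<Rightarrow> real) \<Rightarrow> ('a \<Rightarrow> real) \<Rightarrow> 'a \<Rightarrow> real" where
  "generator p f x = (\<Sum>y\<in>UNIV. p x y * (f y - f x))"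

text \<open>The matrix entries of \<open>exp (t L)\<close>, with \<open>L = generator p\<close>, as an exponential series.\<close>

definition transition_prob :: "('a::finite \<Rightarrow> 'a \<Rightarrow> real) \<Rightarrow> real \<Rightarrow> 'a \<Rightarrow> 'a \<Rightarrow> real" where
  "transition_prob p t x y = (\<Sum>n. t ^ n / fact n * (generator p ^^ n) (indicator {y}) x)"

text \<open>\<open>P x\<close> is the law under which the process \<open>X\<close> starts at \<open>x\<close>. The paths are right-continuous
  for the discrete topology of the state space; the Markov property with generator \<open>generator p\<close>
  is expressed by the finite-dimensional distributions, at times \<open>0 = s 0 \<le> \<dots> \<le> s n\<close>.
  Since \<open>s 0 = 0\<close>, the case \<open>n = 0\<close> gives \<open>X 0 = x\<close> almost surely under \<open>P x\<close>.\<close>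

definition markov_process ::
  "('a::finite \<Rightarrow> 'a \<Rightarrow> real) \<Rightarrow> ('a \<Rightarrow> 'w measure) \<Rightarrow> (real \<Rightarrow> 'w \<Rightarrow> 'a) \<Rightarrow> bool" where
  "markov_process p P X \<longleftrightarrow>
    (\<forall>x. prob_space (P x)) \<and>
    (\<forall>x. \<forall>t\<ge>0. X t \<in> measurable (P x) (count_space UNIV)) \<and>
    (\<forall>x. \<forall>\<omega>\<in>space (P x). \<forall>t\<ge>0. \<forall>\<^sub>F u in at_right t. X u \<omega> = X t \<omega>) \<and>
    (\<forall>x n s z. s 0 = 0 \<longrightarrow> (\<forall>i<n. s i \<le> s (Suc i)) \<longrightarrow>
      \<P>(\<omega> in P x. \<forall>i\<le>n. X (s i) \<omega> = z i) =
        (if z 0 = x then \<Prod>i<n. transition_prob p (s (Suc i) - s i) (z i) (z (Suc i)) else 0))"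

text \<open>The value is \<open>\<infinity>\<close> if \<open>A\<close> is never hit.\<close>

definition hitting_time :: "(real \<Rightarrow> 'w \<Rightarrow> 'a) \<Rightarrow> 'a set \<Rightarrow> 'w \<Rightarrow> ereal" where
  "hitting_time X A \<omega> = Inf {ereal t | t. 0 \<le> t \<and> X t \<omega> \<in> A}"

section \<open>The restricted process and its spectral gap\<close>

abbreviation restricted_measure :: "'a pmf \<Rightarrow> 'a set \<Rightarrow> 'a pmf" where
  "restricted_measure \<mu> R \<equiv> cond_pmf \<mu> R"

definition dirichlet_form ::
  "('a::finite \<Rightarrow> 'a \<Rightarrow> real) \<Rightarrow> 'a pmf \<Rightarrow> 'a set \<Rightarrow> ('a \<Rightarrow> real) \<Rightarrow> real" where
  "dirichlet_form p \<mu> R f =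
    (1 / 2) * (\<Sum>x\<in>R. \<Sum>y\<in>R.
      pmf (restricted_measure \<mu> R) x * restricted_kernel p R x y * (f x - f y)\<^sup>2)"

text \<open>The minimum in the variational formula is written as an infimum over an infinite set of
  reals. Neither the Dirichlet form nor the variance depends on \<open>f\<close> outside \<open>R\<close>.\<close>

definition spectral_gap :: "('a::finite \<Rightarrow> 'a \<Rightarrow> real) \<Rightarrow> 'a pmf \<Rightarrow> 'a set \<Rightarrow> real" where
  "spectral_gap p \<mu> R =
    Inf {dirichlet_form p \<mu> R f / measure_pmf.variance (restricted_measure \<mu> R) f | f.
          measure_pmf.variance (restricted_measure \<mu> R) f \<noteq> 0}"

section \<open>The killed process and its quasi-stationary measure\<close>

text \<open>Spectral radius of the \<open>R \<times> R\<close> matrix with entries \<open>p x y\<close>: the largest modulus of a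
  complex eigenvalue.\<close>

definition spectral_radius_on :: "'a set \<Rightarrow> ('a \<Rightarrow> 'a \<Rightarrow> real) \<Rightarrow> real" where
  "spectral_radius_on R p =
    Sup {cmod l | l. \<exists>f :: 'a \<Rightarrow> complex. (\<exists>x\<in>R. f x \<noteq> 0) \<and>
          (\<forall>x\<in>R. (\<Sum>y\<in>R. complex_of_real (p x y) * f y) = l * f x)}"

definition phi_star :: "('a::finite \<Rightarrow> 'a \<Rightarrow> real) \<Rightarrow> 'a set \<Rightarrow> real" where
  "phi_star p R = 1 - spectral_radius_on R p"

definition mu_star :: "('a::finite \<Rightarrow> 'a \<Rightarrow> real) \<Rightarrow> 'a set \<Rightarrow> 'a pmf" where
  "mu_star p R = (THE \<nu>. set_pmf \<nu> \<subseteq> R \<and>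
    (\<forall>y\<in>R. (\<Sum>x\<in>R. pmf \<nu> x * p x y) = (1 - phi_star p R) * pmf \<nu> y))"

definition eps_star :: "('a::finite \<Rightarrow> 'a \<Rightarrow> real) \<Rightarrow> 'a pmf \<Rightarrow> 'a set \<Rightarrow> real" where
  "eps_star p \<mu> R = phi_star p R / spectral_gap p \<mu> R"

definition h_star :: "('a::finite \<Rightarrow> 'a \<Rightarrow> real) \<Rightarrow> 'a pmf \<Rightarrow> 'a set \<Rightarrow> 'a \<Rightarrow> real" where
  "h_star p \<mu> R x = pmf (mu_star p R) x / pmf (restricted_measure \<mu> R) x"

definition zeta_star :: "('a::finite \<Rightarrow> 'a \<Rightarrow> real) \<Rightarrow> 'a pmf \<Rightarrow> 'a set \<Rightarrow> real" where
  "zeta_star p \<mu> R = Min ((\<lambda>x. pmf (restricted_measure \<mu> R) x * (h_star p \<mu> R x)\<^sup>2) ` R)"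

definition T_star :: "('a::finite \<Rightarrow> 'a \<Rightarrow> real) \<Rightarrow> 'a pmf \<Rightarrow> 'a set \<Rightarrow> real \<Rightarrow> real" where
  "T_star p \<mu> R \<delta> =
    1 / spectral_gap p \<mu> R * ln (2 / (\<delta> * (1 - \<delta>) * zeta_star p \<mu> R)) *
    (1 + sqrt (eps_star p \<mu> R / (1 - eps_star p \<mu> R))) *
    ((1 - eps_star p \<mu> R) / (1 - 3 * eps_star p \<mu> R))"

end

theory Submission
  imports Defs "HOL-Real_Asymp.Real_Asymp"
begin

text \<open>
  Write \<open>m\<close> for the conditioned measure on \<open>R\<close>, \<open>K\<close> for the killed kernel and \<open>h\<close> for its positive
  eigenvector with eigenvalue \<open>1 - \<phi>\<close>, which exists by Brouwer's theorem; \<open>m h\<close> is the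
  quasi-stationary measure. On the \<open>m\<close>-orthogonal complement of \<open>h\<close>, the form of \<open>1 - K\<close> is at
  least \<open>\<gamma>\<close>, the gap of the restricted process: its energy is at most that of the killed process,
  and a function is made centred by subtracting a multiple of \<open>h\<close>, at no cost because \<open>\<phi> < \<gamma>\<close>.
  Hence the killed semigroup is \<open>exp (- \<phi> t)\<close> times the projection on \<open>h\<close> up to an error of
  norm \<open>exp (- \<gamma> t)\<close>, which gives
  \<open>P x (X t = y, \<tau> > t) = exp (- \<phi> t) h x m y h y / \<langle>h, h\<rangle> (1 + \<eta>)\<close> with
  \<open>\<bar>\<eta>\<bar> \<le> exp (- (\<gamma> - \<phi>) t) \<langle>h, h\<rangle> / \<zeta>\<close>. The Poincare inequality for \<open>h\<close> itself bounds
  \<open>\<langle>h, h\<rangle>\<close> by \<open>1 / (1 - \<epsilon>)\<close>, and beyond \<open>T_star\<close> one gets \<open>\<bar>\<eta>\<bar> < \<delta> (1 - \<delta>) / 2\<close>.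

  The killed semigroup enters only as the limit of \<open>(1 - s + s K) ^ N\<close> for \<open>N = 2 ^ n\<close> and
  \<open>s = t / N\<close>, to which the skeleton probabilities at the dyadic times converge.
\<close>

section \<open>Elementary estimates\<close>

lemma one_minus_div_power_limit:
  "(\<lambda>n. (1 - c * (t / 2 ^ n)) ^ 2 ^ n) \<longlonglongrightarrow> exp (- c * t :: real)"
proof -
  have "filterlim (\<lambda>n. 2 ^ n :: nat) sequentially sequentially"
    by (intro filterlim_subseq strict_monoI) simp
  from filterlim_compose[OF tendsto_exp_limit_sequentially[of "- c * t"] this]
  show ?thesis by simp
qed

text \<open>Since \<open>\<nu>\<close> sums to one, the total \<open>sum Q A\<close> inherits the
  relative error \<open>\<eta>\<close> of its terms. Hence the quotient errs by at most
  \<open>2 * \<eta> / (1 - \<eta>)\<close>, which is below \<open>\<delta>\<close>.\<close>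

lemma ratio_close_if_relative_error:
  fixes Q \<nu> :: "'a \<Rightarrow> real"
  assumes A: "finite A" "sum \<nu> A = 1" "\<And>y. y \<in> A \<Longrightarrow> 0 < \<nu> y" and W: "0 < W"
    and Q: "\<And>y. y \<in> A \<Longrightarrow> \<bar>Q y - W * \<nu> y\<bar> \<le> \<eta> * (W * \<nu> y)"
    and \<eta>: "\<eta> < \<delta> * (1 - \<delta>) / 2" and \<delta>: "0 < \<delta>" "\<delta> < 1" and y: "y \<in> A"
  shows "\<bar>Q y / sum Q A / \<nu> y - 1\<bar> < \<delta>"
proof -
  have "0 \<le> \<eta> * (W * \<nu> y)" using Q[OF y] by linarith
  then have \<eta>0: "0 \<le> \<eta>" using W A(3)[OF y] by (metis mult_neg_pos mult_pos_pos not_le)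
  \<comment> \<open>This rearranges to \<open>2 * \<eta> < \<delta> * (1 - \<eta>)\<close>; the
    constant works because \<open>(1 - \<delta>) * (2 + \<delta>) \<le> 2\<close>.\<close>
  have "\<eta> * (2 + \<delta>) < \<delta> * (1 - \<delta>) / 2 * (2 + \<delta>)"
    using \<eta> \<delta> by (intro mult_strict_right_mono) auto
  also have "\<dots> \<le> \<delta> * 1"
  proof -
    have "(1 - \<delta>) / 2 * (2 + \<delta>) \<le> 1" using \<delta> by (simp add: algebra_simps)
    then have "\<delta> * ((1 - \<delta>) / 2 * (2 + \<delta>)) \<le> \<delta> * 1" using \<delta> by (intro mult_left_mono) auto
    then show ?thesis by simp
  qed
  finally have key: "2 * \<eta> < \<delta> * (1 - \<eta>)" by (simp add: algebra_simps)
  then have \<eta>1: "\<eta> < 1" using \<delta> \<eta>0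
    by (smt (verit) mult_nonneg_nonpos)
  have "\<bar>sum Q A - W\<bar> = \<bar>\<Sum>y\<in>A. Q y - W * \<nu> y\<bar>"
    by (simp add: sum_subtractf sum_distrib_left[symmetric] A(2))
  also have "\<dots> \<le> (\<Sum>y\<in>A. \<eta> * (W * \<nu> y))"
    by (intro sum_abs[THEN order_trans] sum_mono Q)
  also have "\<dots> = \<eta> * W" by (simp add: sum_distrib_left[symmetric] A(2))
  finally have S: "\<bar>sum Q A - W\<bar> \<le> \<eta> * W" .
  then have S': "(1 - \<eta>) * W \<le> sum Q A" by (simp add: algebra_simps abs_le_iff)
  moreover have "0 < (1 - \<eta>) * W" using \<eta>1 W by simp
  ultimately have pos: "0 < sum Q A" by linarith
  have "\<bar>Q y - sum Q A * \<nu> y\<bar> \<le> \<bar>Q y - W * \<nu> y\<bar> + \<bar>sum Q A - W\<bar> * \<nu> y"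
  proof -
    have "Q y - sum Q A * \<nu> y = (Q y - W * \<nu> y) - (sum Q A - W) * \<nu> y"
      by (simp add: algebra_simps)
    then show ?thesis
      using abs_triangle_ineq4[of "Q y - W * \<nu> y" "(sum Q A - W) * \<nu> y"] A(3)[OF y]
      by (simp add: abs_mult)
  qed
  also have "\<dots> \<le> \<eta> * (W * \<nu> y) + \<eta> * W * \<nu> y"
    using S Q[OF y] A(3)[OF y] by (intro add_mono mult_right_mono) auto
  also have "\<dots> = 2 * \<eta> * (W * \<nu> y)" by simp
  also have "\<dots> < \<delta> * (1 - \<eta>) * (W * \<nu> y)"
    using key W A(3)[OF y] by (intro mult_strict_right_mono) auto
  also have "\<dots> = \<delta> * ((1 - \<eta>) * W) * \<nu> y" by simp
  also have "\<dots> \<le> \<delta> * sum Q A * \<nu> y"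
    using S' \<delta> A(3)[OF y] by (intro mult_right_mono mult_left_mono) auto
  finally have "\<bar>Q y - sum Q A * \<nu> y\<bar> < \<delta> * (sum Q A * \<nu> y)" by (simp add: mult.assoc)
  moreover have "Q y / sum Q A / \<nu> y - 1 = (Q y - sum Q A * \<nu> y) / (sum Q A * \<nu> y)"
    using pos A(3)[OF y] by (simp add: field_simps)
  ultimately show ?thesis
    using pos A(3)[OF y] by (simp add: abs_mult divide_less_eq)
qed

text \<open>\<open>n\<close> will be \<open>ip h h\<close>. Of the exponent \<open>L + s\<close>
  exceeded beyond \<open>T\<close>, the part \<open>exp (- L)\<close> is exactly
  \<open>\<delta> * (1 - \<delta>) * \<zeta> / 2\<close>, and \<open>exp (- s)\<close> absorbs
  \<open>n \<le> 1 + s\<close>.\<close>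

lemma mixing_time_sufficient:
  fixes \<gamma> \<epsilon> \<delta> \<zeta> n t :: real
  assumes \<gamma>: "0 < \<gamma>" and \<epsilon>: "0 \<le> \<epsilon>" "\<epsilon> < 1 / 3" and \<delta>: "0 < \<delta>" "\<delta> < 1"
    and n: "(1 - \<epsilon>) * n \<le> 1" and \<zeta>: "0 < \<zeta>" "\<zeta> \<le> n"
    and t: "t > 1 / \<gamma> * ln (2 / (\<delta> * (1 - \<delta>) * \<zeta>)) * (1 + sqrt (\<epsilon> / (1 - \<epsilon>))) * ((1 - \<epsilon>) / (1 - 3 * \<epsilon>))"
  shows "0 < t" and "exp (- ((1 - \<epsilon>) * \<gamma>) * t) * n / \<zeta> < \<delta> * (1 - \<delta>) / 2"
proof -
  define L where "L = ln (2 / (\<delta> * (1 - \<delta>) * \<zeta>))"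
  define s where "s = \<epsilon> / (1 - \<epsilon>)"
  define T where "T = 1 / \<gamma> * L * (1 + sqrt s) * ((1 - \<epsilon>) / (1 - 3 * \<epsilon>))"
  have tT: "T < t" using t by (simp add: T_def L_def s_def)
  have s: "0 \<le> s" "s \<le> 1" using \<epsilon> by (simp_all add: s_def)
  have n1: "n \<le> 1 + s" using n \<epsilon> by (simp add: s_def field_simps)
  \<comment> \<open>The crude bound \<open>\<zeta> \<le> n \<le> 3 / 2\<close> makes the argument of
    the logarithm exceed \<open>exp 1\<close>, so that \<open>L \<ge> 1\<close>.\<close>
  have "n \<le> 3 / 2"
  proof -
    have "2 / 3 * n \<le> (1 - \<epsilon>) * n" using \<epsilon> \<zeta> by (intro mult_right_mono) auto
    with n show ?thesis by simp
  qed
  have "\<delta> * (1 - \<delta>) \<le> 1 / 4"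
    using zero_le_power2[of "\<delta> - 1 / 2"] by (simp add: power2_eq_square algebra_simps)
  then have "\<delta> * (1 - \<delta>) * \<zeta> \<le> 1 / 4 * (3 / 2)"
    using \<zeta> \<delta> \<open>n \<le> 3 / 2\<close> by (intro mult_mono) auto
  moreover have dz: "0 < \<delta> * (1 - \<delta>) * \<zeta>" using \<zeta> \<delta> by simp
  ultimately have "3 \<le> 2 / (\<delta> * (1 - \<delta>) * \<zeta>)" by (simp add: le_divide_eq)
  then have "exp 1 \<le> 2 / (\<delta> * (1 - \<delta>) * \<zeta>)" using exp_le by linarith
  then have L: "1 \<le> L" unfolding L_def by (subst ln_ge_iff) (use dz in auto)
  then have "0 \<le> T" unfolding T_def using \<gamma> \<epsilon> s by (intro mult_nonneg_nonneg) auto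
  with tT show "0 < t" by simp
  \<comment> \<open>Killing lowers the rate by a factor \<open>1 - \<epsilon>\<close>; the last
    factor of \<open>T\<close> restores it, as
    \<open>(1 - \<epsilon>)\<^sup>2 \<ge> 1 - 3 * \<epsilon>\<close>, and \<open>1 + sqrt s\<close>
    leaves room for \<open>1 + s\<close>.\<close>
  have "(1 - \<epsilon>) * \<gamma> * T = L * ((1 + sqrt s) * ((1 - \<epsilon>)\<^sup>2 / (1 - 3 * \<epsilon>)))"
    unfolding T_def using \<gamma> by (simp add: power2_eq_square)
  moreover have "1 + s \<le> (1 + sqrt s) * ((1 - \<epsilon>)\<^sup>2 / (1 - 3 * \<epsilon>))"
  proof -
    have "s \<le> sqrt s" using s by (intro real_le_rsqrt) (simp add: power2_eq_square mult_left_le)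
    moreover have "1 \<le> (1 - \<epsilon>)\<^sup>2 / (1 - 3 * \<epsilon>)"
      using \<epsilon> by (simp add: le_divide_eq power2_eq_square algebra_simps)
    ultimately have "(1 + s) * 1 \<le> (1 + sqrt s) * ((1 - \<epsilon>)\<^sup>2 / (1 - 3 * \<epsilon>))"
      using s by (intro mult_mono) auto
    then show ?thesis by simp
  qed
  ultimately have "L * (1 + s) \<le> (1 - \<epsilon>) * \<gamma> * T"
    using L mult_left_mono[of "1 + s" _ L] by (metis order_trans zero_le_one)
  \<comment> \<open>Here \<open>L \<ge> 1\<close> is used: \<open>L * s\<close> is at least
    \<open>s\<close>.\<close>
  moreover have "L + s \<le> L * (1 + s)"
    using L s mult_right_mono[of 1 L s] by (simp add: distrib_left)
  moreover have "(1 - \<epsilon>) * \<gamma> * T < (1 - \<epsilon>) * \<gamma> * t"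
    using tT \<gamma> \<epsilon> by (intro mult_strict_left_mono) auto
  ultimately have "L + s < (1 - \<epsilon>) * \<gamma> * t" by linarith
  then have "exp (- ((1 - \<epsilon>) * \<gamma>) * t) < exp (- (L + s))" by simp
  also have "\<dots> = exp (- L) * exp (- s)" by (simp add: exp_add[symmetric])
  also have "exp (- L) = \<delta> * (1 - \<delta>) * \<zeta> / 2"
    unfolding L_def using dz by (simp add: exp_minus)
  finally have "exp (- ((1 - \<epsilon>) * \<gamma>) * t) * n < \<delta> * (1 - \<delta>) * \<zeta> / 2 * exp (- s) * n"
    using \<zeta> by (intro mult_strict_right_mono) auto
  also have "\<dots> = \<delta> * (1 - \<delta>) * \<zeta> / 2 * (exp (- s) * n)" by simp
  also have "\<dots> \<le> \<delta> * (1 - \<delta>) * \<zeta> / 2 * 1"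
  proof (intro mult_left_mono)
    have "n \<le> exp s" using n1 exp_ge_add_one_self[of s] by linarith
    then show "exp (- s) * n \<le> 1" by (simp add: exp_minus field_simps)
  qed (use dz in simp)
  finally show "exp (- ((1 - \<epsilon>) * \<gamma>) * t) * n / \<zeta> < \<delta> * (1 - \<delta>) / 2"
    using \<zeta> by (simp add: field_simps)
qed

section \<open>The Dirichlet form of a killed kernel\<close>

text \<open>Connectedness is stated for \<open>p\<close> itself, whose off-diagonal entries are
  those of the restricted kernel. Rows of \<open>p\<close> cut down to \<open>R\<close> may lose
  mass: this is the killing.\<close>

locale killed_kernel =
  fixes p :: "'a::finite \<Rightarrow> 'a \<Rightarrow> real" and m :: "'a \<Rightarrow> real" and R :: "'a set"
  assumes p_nonneg: "0 \<le> p x y"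
    and p_sum: "(\<Sum>y\<in>UNIV. p x y) = 1"
    and m_pos: "x \<in> R \<Longrightarrow> 0 < m x"
    and m_sum: "(\<Sum>x\<in>R. m x) = 1"
    and detailed_balance: "x \<in> R \<Longrightarrow> y \<in> R \<Longrightarrow> m x * p x y = m y * p y x"
    and communicate: "x \<in> R \<Longrightarrow> y \<in> R \<Longrightarrow> (x, y) \<in> {(u, v). u \<in> R \<and> v \<in> R \<and> p u v > 0}\<^sup>*"
begin

definition ip :: "('a \<Rightarrow> real) \<Rightarrow> ('a \<Rightarrow> real) \<Rightarrow> real" where
  "ip f g = (\<Sum>x\<in>R. m x * f x * g x)"

definition killed :: "('a \<Rightarrow> real) \<Rightarrow> 'a \<Rightarrow> real" where
  "killed f x = (\<Sum>y\<in>R. p x y * f y)"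

definition energy :: "('a \<Rightarrow> real) \<Rightarrow> real" where
  "energy f = (1 / 2) * (\<Sum>x\<in>R. \<Sum>y\<in>R. m x * p x y * (f x - f y)\<^sup>2)"

text \<open>An Euler step of size \<open>s\<close> for the semigroup generated by
  \<open>killed\<close> minus the identity.\<close>

definition lazy :: "real \<Rightarrow> ('a \<Rightarrow> real) \<Rightarrow> 'a \<Rightarrow> real" where
  "lazy s f x = (1 - s) * f x + s * killed f x"

section \<open>Inner product weighted by \<open>m\<close> and the killed operator on it\<close>

lemma m_nonneg: "x \<in> R \<Longrightarrow> 0 \<le> m x"
  using m_pos by (simp add: less_imp_le)

lemma row_le: "(\<Sum>y\<in>R. p x y) \<le> 1"
  using sum_mono2[of UNIV R "p x"] p_nonneg p_sum[of x] by simp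

lemma ip_commute: "ip f g = ip g f"
  by (simp add: ip_def mult_ac)

lemma ip_add: "ip f (\<lambda>x. u x + v x) = ip f u + ip f v"
  by (simp add: ip_def distrib_left sum.distrib)

lemma ip_diff: "ip f (\<lambda>x. u x - v x) = ip f u - ip f v"
  by (simp add: ip_def right_diff_distrib sum_subtractf)

lemma ip_scale: "ip f (\<lambda>x. c * u x) = c * ip f u"
  by (simp add: ip_def sum_distrib_left mult_ac)

lemma ip_diff': "ip (\<lambda>x. u x - v x) f = ip u f - ip v f"
  by (metis ip_commute ip_diff)

lemma ip_scale': "ip (\<lambda>x. c * u x) f = c * ip u f"
  by (metis ip_commute ip_scale)

lemma ip_cong: "(\<And>x. x \<in> R \<Longrightarrow> f x = f' x) \<Longrightarrow> (\<And>x. x \<in> R \<Longrightarrow> g x = g' x) \<Longrightarrow> ip f g = ip f' g'"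
  by (simp add: ip_def)

lemma ip_nonneg: "0 \<le> ip f f"
  unfolding ip_def by (intro sum_nonneg) (auto simp: mult.assoc m_nonneg)

lemma ip_pos: "x \<in> R \<Longrightarrow> f x \<noteq> 0 \<Longrightarrow> 0 < ip f f"
  unfolding ip_def
  by (intro sum_pos2[of R x]) (auto simp: mult.assoc m_nonneg m_pos zero_less_mult_iff)

lemma point_le_ip: "x \<in> R \<Longrightarrow> m x * (f x)\<^sup>2 \<le> ip f f"
  unfolding ip_def power2_eq_square mult.assoc[symmetric]
  by (intro member_le_sum) (auto simp: mult.assoc m_nonneg)

lemma killed_diff: "killed (\<lambda>x. u x - v x) x = killed u x - killed v x"
  by (simp add: killed_def right_diff_distrib sum_subtractf)

lemma killed_scale: "killed (\<lambda>x. c * u x) x = c * killed u x"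
  by (simp add: killed_def sum_distrib_left mult_ac)

lemma killed_cong: "(\<And>x. x \<in> R \<Longrightarrow> f x = g x) \<Longrightarrow> killed f = killed g"
  by (simp add: killed_def fun_eq_iff)

lemma killed_selfadjoint: "ip f (killed g) = ip (killed f) g"
proof -
  have "ip f (killed g) = (\<Sum>x\<in>R. \<Sum>y\<in>R. m x * p x y * f x * g y)"
    by (simp add: ip_def killed_def sum_distrib_left mult_ac)
  also have "\<dots> = (\<Sum>x\<in>R. \<Sum>y\<in>R. m y * p y x * f x * g y)"
    by (intro sum.cong) (auto simp: detailed_balance)
  also have "\<dots> = (\<Sum>y\<in>R. \<Sum>x\<in>R. m y * p y x * f x * g y)"
    by (rule sum.swap)
  also have "\<dots> = ip (killed f) g"
    by (simp add: ip_def killed_def sum_distrib_left sum_distrib_right mult_ac)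
  finally show ?thesis .
qed

text \<open>Expanding the square gives the killed form as cross term, and each of the two square
  terms is at most \<open>ip f f\<close> because rows over \<open>R\<close> sum to at most one. The
  sign \<open>c = -1\<close> yields the energy, \<open>c = 1\<close> the lower bound
  \<open>killed \<ge> -1\<close>.\<close>

lemma form_bound:
  assumes "c\<^sup>2 = (1 :: real)"
  shows "(1 / 2) * (\<Sum>x\<in>R. \<Sum>y\<in>R. m x * p x y * (f x + c * f y)\<^sup>2) \<le> ip f f + c * ip f (killed f)"
proof -
  define S where "S = (\<Sum>x\<in>R. \<Sum>y\<in>R. m x * p x y * (f x)\<^sup>2)"
  have S2: "(\<Sum>x\<in>R. \<Sum>y\<in>R. m x * p x y * (f y)\<^sup>2) = S"
    unfolding S_def by (subst sum.swap) (intro sum.cong, auto simp: detailed_balance)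
  have "S = (\<Sum>x\<in>R. m x * (f x)\<^sup>2 * (\<Sum>y\<in>R. p x y))"
    by (simp only: S_def sum_distrib_left mult.assoc mult.commute[of "(f _)\<^sup>2"])
  also have "\<dots> \<le> (\<Sum>x\<in>R. m x * (f x)\<^sup>2 * 1)"
    by (intro sum_mono mult_left_mono row_le) (auto simp: m_nonneg)
  finally have SI: "S \<le> ip f f"
    by (simp add: ip_def power2_eq_square mult_ac)
  have K: "ip f (killed f) = (\<Sum>x\<in>R. \<Sum>y\<in>R. m x * p x y * (f x * f y))"
    by (simp add: ip_def killed_def sum_distrib_left mult_ac)
  have "m x * p x y * (f x + c * f y)\<^sup>2 = m x * p x y * (f x)\<^sup>2 + m x * p x y * (f y)\<^sup>2
      + 2 * c * (m x * p x y * (f x * f y))" for x y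
  proof -
    have "(f x + c * f y)\<^sup>2 = (f x)\<^sup>2 + (f y)\<^sup>2 + 2 * c * (f x * f y)"
      using assms by (simp add: power2_sum power_mult_distrib)
    then show ?thesis by (simp add: algebra_simps)
  qed
  then have "(\<Sum>x\<in>R. \<Sum>y\<in>R. m x * p x y * (f x + c * f y)\<^sup>2) = S + S + 2 * c * ip f (killed f)"
    by (simp only: sum.distrib sum_distrib_left[symmetric] S_def[symmetric] S2 K)
  with SI show ?thesis by simp
qed

lemma energy_le: "energy f \<le> ip f f - ip f (killed f)"
  using form_bound[of "-1" f] by (simp add: energy_def)

lemma killed_ge: "- ip f f \<le> ip f (killed f)"
proof -
  have "0 \<le> (\<Sum>x\<in>R. \<Sum>y\<in>R. m x * p x y * (f x + 1 * f y)\<^sup>2)"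
    by (intro sum_nonneg) (auto simp: m_nonneg p_nonneg)
  with form_bound[of 1 f] show ?thesis by simp
qed

lemma energy_nonneg: "0 \<le> energy f"
  unfolding energy_def
  by (intro mult_nonneg_nonneg sum_nonneg) (auto simp: m_nonneg p_nonneg)

section \<open>Poincare inequality by comparison along paths\<close>

lemma edge_le_energy:
  assumes "x \<in> R" "y \<in> R"
  shows "m x * p x y * (f x - f y)\<^sup>2 \<le> 2 * energy f"
proof -
  have "m x * p x y * (f x - f y)\<^sup>2 \<le> (\<Sum>y\<in>R. m x * p x y * (f x - f y)\<^sup>2)"
    using assms by (intro member_le_sum) (auto simp: m_nonneg p_nonneg)
  also have "\<dots> \<le> (\<Sum>x\<in>R. \<Sum>y\<in>R. m x * p x y * (f x - f y)\<^sup>2)"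
    using assms
    by (intro member_le_sum[of x R "\<lambda>x. \<Sum>y\<in>R. m x * p x y * (f x - f y)\<^sup>2"])
      (auto intro!: sum_nonneg simp: m_nonneg p_nonneg)
  finally show ?thesis by (simp add: energy_def)
qed

text \<open>Follow one path from \<open>x\<close> to \<open>y\<close> and split the increment with
  \<open>(a + b)\<^sup>2 \<le> 2 * a\<^sup>2 + 2 * b\<^sup>2\<close>; each edge is paid for by the
  energy.\<close>

lemma path_le_energy:
  assumes "x \<in> R" "y \<in> R"
  shows "\<exists>C\<ge>0. \<forall>f. (f x - f y)\<^sup>2 \<le> C * energy f"
  using communicate[OF assms]
proof induction
  case base
  show ?case by (intro exI[of _ 0]) auto
next
  case (step u v)
  then obtain C where C: "0 \<le> C" "\<And>f. (f x - f u)\<^sup>2 \<le> C * energy f" by blast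
  from step have uv: "u \<in> R" "v \<in> R" "0 < p u v" by auto
  define w where "w = m u * p u v"
  have w: "0 < w" using uv by (simp add: w_def m_pos)
  \<comment> \<open>The last edge costs \<open>2 / w\<close> by \<open>edge_le_energy\<close>,
    doubled by the splitting.\<close>
  have "(f x - f v)\<^sup>2 \<le> (2 * C + 4 / w) * energy f" for f
  proof -
    have "(f u - f v)\<^sup>2 \<le> 2 / w * energy f"
      using edge_le_energy[OF uv(1,2), of f] w by (simp add: w_def[symmetric] field_simps)
    moreover have "(f x - f v)\<^sup>2 \<le> 2 * (f x - f u)\<^sup>2 + 2 * (f u - f v)\<^sup>2"
    proof -
      have "2 * (f x - f u)\<^sup>2 + 2 * (f u - f v)\<^sup>2 - (f x - f v)\<^sup>2 = ((f x - f u) - (f u - f v))\<^sup>2"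
        by (simp add: power2_eq_square algebra_simps)
      then show ?thesis by (metis diff_ge_0_iff_ge zero_le_power2)
    qed
    ultimately show ?thesis using C(2)[of f] by (simp add: distrib_right)
  qed
  then show ?case using C(1) w by (intro exI[of _ "2 * C + 4 / w"]) auto
qed

text \<open>Twice the variance is the mean of \<open>(f x - f y)\<^sup>2\<close> over independent
  \<open>x\<close> and \<open>y\<close>, and each pair is bounded by \<open>path_le_energy\<close>.
  This will show that the spectral gap is positive.\<close>

lemma poincare: "\<exists>C>0. \<forall>f. ip f f - (ip (\<lambda>_. 1) f)\<^sup>2 \<le> C * energy f"
proof -
  have "\<forall>x y. \<exists>C\<ge>0. x \<in> R \<longrightarrow> y \<in> R \<longrightarrow> (\<forall>f. (f x - f y)\<^sup>2 \<le> C * energy f)"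
    using path_le_energy by (metis order_refl)
  then obtain C where C: "\<And>x y. 0 \<le> C x y"
    "\<And>x y f. x \<in> R \<Longrightarrow> y \<in> R \<Longrightarrow> (f x - f y)\<^sup>2 \<le> C x y * energy f" by metis
  define T where "T = (\<Sum>x\<in>R. \<Sum>y\<in>R. m x * m y * C x y)"
  have T0: "0 \<le> T" unfolding T_def by (intro sum_nonneg) (auto simp: C m_nonneg)
  \<comment> \<open>Adding one keeps the constant positive even if \<open>T\<close>
    vanishes.\<close>
  have "ip f f - (ip (\<lambda>_. 1) f)\<^sup>2 \<le> (T + 1) * energy f" for f
  proof -
    have E: "(\<Sum>x\<in>R. \<Sum>y\<in>R. m x * m y * (f x - f y)\<^sup>2) = 2 * (ip f f - (ip (\<lambda>_. 1) f)\<^sup>2)"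
    proof -
      have 1: "(\<Sum>x\<in>R. \<Sum>y\<in>R. m x * m y * (f x)\<^sup>2) = ip f f"
      proof -
        have "(\<Sum>x\<in>R. \<Sum>y\<in>R. m x * m y * (f x)\<^sup>2) = (\<Sum>x\<in>R. m x * (f x)\<^sup>2 * (\<Sum>y\<in>R. m y))"
          by (simp only: sum_distrib_left mult.assoc mult.commute[of "(f _)\<^sup>2"])
        then show ?thesis by (simp add: m_sum ip_def power2_eq_square mult_ac)
      qed
      have 2: "(\<Sum>x\<in>R. \<Sum>y\<in>R. m x * m y * (f y)\<^sup>2) = ip f f"
        by (subst sum.swap) (subst 1[symmetric], simp add: mult_ac)
      have 3: "(\<Sum>x\<in>R. \<Sum>y\<in>R. m x * m y * (f x * f y)) = (ip (\<lambda>_. 1) f)\<^sup>2"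
        by (simp add: ip_def power2_eq_square sum_product mult_ac)
      have "m x * m y * (f x - f y)\<^sup>2
          = m x * m y * (f x)\<^sup>2 + m x * m y * (f y)\<^sup>2 - 2 * (m x * m y * (f x * f y))" for x y
        by (simp add: power2_eq_square algebra_simps)
      then have "(\<Sum>x\<in>R. \<Sum>y\<in>R. m x * m y * (f x - f y)\<^sup>2)
          = ip f f + ip f f - 2 * (\<Sum>x\<in>R. \<Sum>y\<in>R. m x * m y * (f x * f y))"
        by (simp only: sum_subtractf sum.distrib sum_distrib_left[symmetric] 1 2)
      then show ?thesis by (simp only: 3 right_diff_distrib mult_2)
    qed
    have "(\<Sum>x\<in>R. \<Sum>y\<in>R. m x * m y * (f x - f y)\<^sup>2) \<le> (\<Sum>x\<in>R. \<Sum>y\<in>R. m x * m y * (C x y * energy f))"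
      by (intro sum_mono mult_left_mono C) (auto simp: m_nonneg)
    also have "\<dots> = T * energy f"
      by (simp only: T_def sum_distrib_right mult.assoc)
    finally have "2 * (ip f f - (ip (\<lambda>_. 1) f)\<^sup>2) \<le> T * energy f" by (simp only: E)
    moreover have "0 \<le> T * energy f" using T0 energy_nonneg by simp
    ultimately show ?thesis using energy_nonneg[of f] by (simp add: distrib_right)
  qed
  with T0 show ?thesis by (intro exI[of _ "T + 1"]) auto
qed

section \<open>Perron eigenvector of the killed kernel\<close>

lemma eigenvector_pos:
  assumes nonneg: "\<And>x. x \<in> R \<Longrightarrow> 0 \<le> f x"
    and eig: "\<And>x. x \<in> R \<Longrightarrow> killed f x = l * f x"
    and nz: "y \<in> R" "f y \<noteq> 0" and x: "x \<in> R"
  shows "0 < f x"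
proof (rule ccontr)
  assume "\<not> 0 < f x"
  with nonneg[OF x] have "f x = 0" by simp
  \<comment> \<open>At a zero of \<open>f\<close> the eigenvalue equation makes a sum of nonnegative
    terms vanish, so zeros spread along edges and reach \<open>y\<close>.\<close>
  have "f z = 0" if "(x, z) \<in> {(u, v). u \<in> R \<and> v \<in> R \<and> p u v > 0}\<^sup>*" for z
    using that
  proof induction
    case base
    show ?case by fact
  next
    case (step u v)
    then have uv: "u \<in> R" "v \<in> R" "0 < p u v" by auto
    have "(\<Sum>y\<in>R. p u y * f y) = 0"
      using eig[OF uv(1)] step.IH by (simp add: killed_def)
    then have "p u v * f v = 0"
      using uv by (subst (asm) sum_nonneg_eq_0_iff) (auto simp: p_nonneg nonneg)
    with uv show ?case by simp
  qed
  with communicate[OF x nz(1)] nz(2) show False by blast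
qed

text \<open>Brouwer's theorem for the map taking \<open>v\<close> to the normalised
  \<open>v + killed v\<close>, on nonnegative functions of \<open>m\<close>-mean one. Adding
  \<open>v\<close> keeps the normalising factor away from zero; a fixed point is an eigenvector with
  eigenvalue \<open>Z v - 1\<close>.\<close>

lemma perron_vector:
  obtains h l where "\<And>x. x \<in> R \<Longrightarrow> 0 < h x" "ip (\<lambda>_. 1) h = 1"
    "\<And>x. x \<in> R \<Longrightarrow> killed h x = l * h x" "0 \<le> l"
proof -
  have ne: "R \<noteq> {}" using m_sum by auto
  define S where "S = {v :: real ^ 'a. (\<forall>x. 0 \<le> v $ x) \<and> (\<forall>x. x \<notin> R \<longrightarrow> v $ x = 0) \<and> (\<Sum>x\<in>R. m x * v $ x) = 1}"
  define Z where "Z v = 1 + (\<Sum>x\<in>R. m x * killed (($) v) x)" for v :: "real ^ 'a"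
  define F where "F v = (\<chi> x. if x \<in> R then (v $ x + killed (($) v) x) / Z v else 0)"
    for v :: "real ^ 'a"
  have Z1: "1 \<le> Z v" if "v \<in> S" for v
    using that unfolding Z_def S_def killed_def
    by (auto intro!: sum_nonneg mult_nonneg_nonneg simp: m_nonneg p_nonneg)
  have "compact S"
  proof -
    have "S = (\<Inter>x. {v. 0 \<le> v $ x}) \<inter> (\<Inter>x\<in>-R. {v. v $ x = 0}) \<inter> {v. (\<Sum>x\<in>R. m x * v $ x) = 1}"
      by (auto simp: S_def)
    also have "closed \<dots>"
      by (intro closed_Int closed_INT ballI closed_Collect_le closed_Collect_eq)
        (auto intro!: continuous_intros)
    finally have "closed S" .
    moreover have "bounded S"
    proof -
      \<comment> \<open>On \<open>S\<close> each \<open>m x * v $ x\<close> is at most one, being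
        one of several nonnegative terms with sum one.\<close>
      define M where "M = (\<Sum>x\<in>R. 1 / m x)"
      have "norm v \<le> real CARD('a) * M" if v: "v \<in> S" for v
      proof -
        have M0: "0 \<le> M" unfolding M_def by (intro sum_nonneg) (auto simp: m_nonneg)
        have "\<bar>v $ x\<bar> \<le> M" for x
        proof (cases "x \<in> R")
          case True
          have "m x * v $ x \<le> 1"
            using v True member_le_sum[of x R "\<lambda>x. m x * v $ x"] by (auto simp: S_def m_nonneg)
          then have "v $ x \<le> 1 / m x" using m_pos[OF True] by (simp add: field_simps)
          also have "\<dots> \<le> M" unfolding M_def
            using True by (intro member_le_sum) (auto simp: m_nonneg)
          finally show ?thesis using v by (simp add: S_def)
        next
          case False
          then show ?thesis using v M0 by (simp add: S_def)
        qed
        then have "(\<Sum>x\<in>UNIV. \<bar>v $ x\<bar>) \<le> (\<Sum>x\<in>(UNIV::'a set). M)" by (intro sum_mono)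
        with norm_le_l1_cart[of v] show ?thesis by simp
      qed
      then show ?thesis by (auto simp: bounded_iff)
    qed
    ultimately show ?thesis by (simp add: compact_eq_bounded_closed)
  qed
  moreover have "convex S"
  proof (rule convexI)
    fix v w :: "real ^ 'a" and a b :: real
    assume vw: "v \<in> S" "w \<in> S" and ab: "0 \<le> a" "0 \<le> b" "a + b = 1"
    have "(\<Sum>x\<in>R. m x * (a * v $ x + b * w $ x)) = a * (\<Sum>x\<in>R. m x * v $ x) + b * (\<Sum>x\<in>R. m x * w $ x)"
      by (simp add: distrib_left sum.distrib sum_distrib_left mult_ac)
    with vw ab show "a *\<^sub>R v + b *\<^sub>R w \<in> S" by (simp add: S_def)
  qed
  moreover have "S \<noteq> {}"
  proof -
    have "(\<chi> x. if x \<in> R then 1 else 0) \<in> S"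
      by (simp add: S_def m_sum)
    then show ?thesis by blast
  qed
  moreover have "continuous_on S F"
  proof -
    have "continuous_on S (\<lambda>v. F v $ x)" for x
    proof (cases "x \<in> R")
      case True
      have "Z v \<noteq> 0" if "v \<in> S" for v using Z1[OF that] by simp
      moreover have "continuous_on S Z"
        unfolding Z_def[abs_def] killed_def by (intro continuous_intros)
      moreover have "continuous_on S (\<lambda>v. v $ x + killed (($) v) x)"
        unfolding killed_def by (intro continuous_intros)
      ultimately have "continuous_on S (\<lambda>v. (v $ x + killed (($) v) x) / Z v)"
        by (intro continuous_on_divide) auto
      with True show ?thesis by (simp add: F_def)
    qed (simp add: F_def)
    then show ?thesis
      by (subst continuous_on_componentwise)
        (auto simp: Basis_vec_def inner_axis)
  qed
  moreover have "F \<in> S \<rightarrow> S"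
  proof
    fix v assume v: "v \<in> S"
    have "(\<Sum>x\<in>R. m x * F v $ x) = (\<Sum>x\<in>R. m x * v $ x + m x * killed (($) v) x) / Z v"
      by (simp add: F_def sum_divide_distrib distrib_left)
    also have "\<dots> = 1"
      using v Z1[OF v] by (simp add: sum.distrib Z_def S_def)
    finally have "(\<Sum>x\<in>R. m x * F v $ x) = 1" .
    moreover have "0 \<le> killed (($) v) x" for x
      using v unfolding killed_def S_def by (auto intro!: sum_nonneg simp: p_nonneg)
    ultimately show "F v \<in> S"
      using v Z1[OF v] by (auto simp: S_def F_def)
  qed
  ultimately obtain v where v: "v \<in> S" "F v = v" by (rule brouwer)
  have eig: "killed (($) v) x = (Z v - 1) * v $ x" if "x \<in> R" for x
  proof -
    have "v $ x = (v $ x + killed (($) v) x) / Z v"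
      using that arg_cong[OF v(2), of "\<lambda>w. w $ x"] by (simp add: F_def)
    then show ?thesis using Z1[OF v(1)] by (simp add: field_simps)
  qed
  have one: "(\<Sum>x\<in>R. m x * v $ x) = 1" using v by (simp add: S_def)
  then obtain y where y: "y \<in> R" "v $ y \<noteq> 0"
    by (metis (mono_tags, lifting) mult_zero_right sum.neutral zero_neq_one)
  show thesis
  proof (rule that)
    show "0 < v $ x" if "x \<in> R" for x
      using v(1) by (intro eigenvector_pos[OF _ eig y that]) (auto simp: S_def)
  qed (use eig one Z1[OF v(1)] in \<open>auto simp: ip_def\<close>)
qed

end

section \<open>Contraction on the orthogonal complement of the ground state\<close>

context killed_kernel
begin

section \<open>Powers of the lazy operator\<close>

lemma lazy_add: "lazy s (\<lambda>x. u x + v x) = (\<lambda>x. lazy s u x + lazy s v x)"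
  by (simp add: lazy_def killed_def fun_eq_iff algebra_simps sum.distrib sum_distrib_left)

lemma lazy_scale: "lazy s (\<lambda>x. c * u x) = (\<lambda>x. c * lazy s u x)"
  by (simp add: lazy_def killed_scale fun_eq_iff algebra_simps)

lemma lazy_diff: "lazy s (\<lambda>x. u x - c * v x) = (\<lambda>x. lazy s u x - c * lazy s v x)"
  by (simp add: lazy_def killed_diff killed_scale fun_eq_iff algebra_simps)

lemma lazy_power_linear:
  "(lazy s ^^ n) (\<lambda>x. c * u x + v x) = (\<lambda>x. c * (lazy s ^^ n) u x + (lazy s ^^ n) v x)"
  by (induction n) (simp_all add: lazy_add lazy_scale)

text \<open>For \<open>s\<close> in the unit interval \<open>lazy s\<close> averages with total
  weight at most one, so it does not increase the supremum norm over \<open>R\<close>.\<close>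

lemma lazy_abs_le:
  assumes "0 \<le> s" "s \<le> 1" and f: "\<And>x. x \<in> R \<Longrightarrow> \<bar>f x\<bar> \<le> M" and "x \<in> R"
  shows "\<bar>lazy s f x\<bar> \<le> M"
proof -
  have "0 \<le> M" using f[OF \<open>x \<in> R\<close>] by simp
  have "\<bar>killed f x\<bar> \<le> (\<Sum>y\<in>R. p x y * M)"
    unfolding killed_def
    by (intro sum_abs[THEN order_trans] sum_mono)
      (auto simp: abs_mult p_nonneg intro!: mult_left_mono f)
  also have "\<dots> \<le> M"
    using row_le[of x] \<open>0 \<le> M\<close> by (simp add: sum_distrib_right[symmetric] mult_left_le_one_le sum_nonneg p_nonneg)
  finally have "\<bar>(1 - s) * f x\<bar> + \<bar>s * killed f x\<bar> \<le> (1 - s) * M + s * M"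
    using assms f[OF \<open>x \<in> R\<close>] by (intro add_mono) (auto simp: abs_mult intro!: mult_left_mono)
  then show ?thesis
    unfolding lazy_def by (simp add: algebra_simps)
qed

lemma lazy_power_abs_le:
  assumes "0 \<le> s" "s \<le> 1" and f: "\<And>x. x \<in> R \<Longrightarrow> \<bar>f x\<bar> \<le> M" and "x \<in> R"
  shows "\<bar>(lazy s ^^ n) f x\<bar> \<le> M"
  using \<open>x \<in> R\<close> by (induction n arbitrary: x) (auto intro!: lazy_abs_le assms)

lemma ip_lazy: "ip f (lazy s g) = (1 - s) * ip f g + s * ip f (killed g)"
  unfolding lazy_def[abs_def] by (simp only: ip_add ip_scale)

end

text \<open>\<open>h\<close> has \<open>m\<close>-mean one, so that \<open>m h\<close> is a
  probability; \<open>g\<close> is any Poincare constant of the restricted process larger than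
  \<open>\<phi>\<close>.\<close>

locale quasi_stationary = killed_kernel +
  fixes h :: "'a \<Rightarrow> real" and \<phi> g :: real
  assumes h_pos: "x \<in> R \<Longrightarrow> 0 < h x"
    and h_mean: "ip (\<lambda>_. 1) h = 1"
    and h_eig: "x \<in> R \<Longrightarrow> killed h x = (1 - \<phi>) * h x"
    and gap: "g * (ip f f - (ip (\<lambda>_. 1) f)\<^sup>2) \<le> energy f"
    and phi_less: "\<phi> < g"
begin

section \<open>Consequences of the gap for the ground state and its complement\<close>

lemma ip_h_killed: "ip h (killed f) = (1 - \<phi>) * ip h f"
proof -
  have "ip (killed h) f = ip (\<lambda>x. (1 - \<phi>) * h x) f"
    by (intro ip_cong) (simp_all add: h_eig)
  then show ?thesis by (simp only: killed_selfadjoint ip_scale')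
qed

text \<open>Average the eigenvalue equation over \<open>m\<close>: by symmetry the mean of
  \<open>killed h\<close> is that of \<open>h\<close> weighted by the row sums, which are at most
  one.\<close>

lemma phi_nonneg: "0 \<le> \<phi>"
proof -
  have "1 - \<phi> = ip (\<lambda>_. 1) (killed h)"
    using ip_cong[of "\<lambda>_. 1" "\<lambda>_. 1" "killed h" "\<lambda>x. (1 - \<phi>) * h x"] h_eig
    by (simp add: ip_scale h_mean)
  also have "\<dots> = ip (killed (\<lambda>_. 1)) h" by (rule killed_selfadjoint)
  also have "\<dots> \<le> ip (\<lambda>_. 1) h"
    unfolding ip_def killed_def
    using h_pos row_le m_nonneg
    by (intro sum_mono mult_right_mono mult_left_mono) (auto simp: less_imp_le)
  finally show ?thesis by (simp add: h_mean)
qed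

lemma gap_pos: "0 < g"
  using phi_nonneg phi_less by simp

text \<open>The Poincare inequality at \<open>h\<close>: the variance is \<open>ip h h - 1\<close>,
  while the form of \<open>1 - killed\<close> is \<open>\<phi> * ip h h\<close>.\<close>

lemma norm_h_le: "(g - \<phi>) * ip h h \<le> g"
proof -
  have "g * (ip h h - 1) \<le> ip h h - ip h (killed h)"
    using gap[of h] energy_le[of h] by (simp add: h_mean)
  also have "\<dots> = \<phi> * ip h h" by (simp add: ip_h_killed algebra_simps)
  finally show ?thesis by (simp add: algebra_simps)
qed

lemma norm_h_pos: "0 < ip h h"
proof -
  obtain x where "x \<in> R" using m_sum by fastforce
  with h_pos[OF this] show ?thesis by (intro ip_pos[of x]) auto
qed

text \<open>Subtracting a multiple of \<open>h\<close> makes \<open>f\<close> centred, so that the Poincare inequality of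
  the restricted process applies; the energy of that multiple is at most its share of the
  variance because \<open>\<phi> < g\<close>.\<close>

lemma perp_gap:
  assumes perp: "ip h f = 0"
  shows "g * ip f f \<le> ip f f - ip f (killed f)"
proof -
  define a where "a = ip (\<lambda>_. 1) f"
  define u where "u x = f x - a * h x" for x
  have fh: "ip f h = 0" using perp by (simp add: ip_commute)
  have mean: "ip (\<lambda>_. 1) u = 0"
    unfolding u_def by (simp add: ip_diff ip_scale h_mean a_def)
  \<comment> \<open>\<open>h\<close> is orthogonal both to \<open>f\<close> and to
    \<open>killed f\<close>, so all cross terms vanish here and in \<open>uku\<close>.\<close>
  have uu: "ip u u = ip f f + a\<^sup>2 * ip h h"
    unfolding u_def by (simp add: ip_diff ip_diff' ip_scale ip_scale' perp fh power2_eq_square)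
  have ku: "killed u = (\<lambda>x. killed f x - a * killed h x)"
    unfolding u_def by (simp add: killed_diff killed_scale fun_eq_iff)
  have fkh: "ip f (killed h) = 0"
    by (metis ip_commute ip_h_killed killed_selfadjoint perp mult_zero_right)
  have uku: "ip u (killed u) = ip f (killed f) + a\<^sup>2 * (1 - \<phi>) * ip h h"
    unfolding ku unfolding u_def
    by (simp add: ip_diff ip_diff' ip_scale ip_scale' ip_h_killed fkh perp power2_eq_square)
  have "g * ip u u \<le> ip u u - ip u (killed u)"
    using gap[of u] energy_le[of u] mean by simp
  then have "g * ip f f + (g - \<phi>) * (a\<^sup>2 * ip h h) \<le> ip f f - ip f (killed f)"
    unfolding uu uku by (simp add: algebra_simps)
  moreover have "0 \<le> (g - \<phi>) * (a\<^sup>2 * ip h h)"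
    using phi_less ip_nonneg by simp
  ultimately show ?thesis by simp
qed

lemma perp_lazy: "ip h f = 0 \<Longrightarrow> ip h (lazy s f) = 0"
  by (simp add: ip_lazy ip_h_killed)

text \<open>With \<open>q = 1 - s g\<close>, evaluating the positive form \<open>ip w (lazy s w)\<close> at
  \<open>w = f - (1 / q) lazy s f\<close> replaces the spectral theorem.\<close>

lemma lazy_contracts:
  assumes perp: "ip h f = 0" and s: "0 < s" "s \<le> 1 / 2" "s * g < 1"
  shows "ip (lazy s f) (lazy s f) \<le> (1 - s * g)\<^sup>2 * ip f f"
proof -
  define q where "q = 1 - s * g"
  have q: "0 < q" using s by (simp add: q_def)
  have form_le: "ip u (lazy s u) \<le> q * ip u u" if "ip h u = 0" for u
    using mult_left_mono[OF perp_gap[OF that], of s] s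
    by (simp add: ip_lazy q_def algebra_simps)
  \<comment> \<open>Since \<open>killed \<ge> -1\<close> and \<open>s \<le> 1 / 2\<close>, the form
    is at least \<open>(1 - 2 * s) * ip u u \<ge> 0\<close>.\<close>
  have form_nonneg: "0 \<le> ip u (lazy s u)" for u
  proof -
    have "0 \<le> (1 - 2 * s) * ip u u" using s ip_nonneg by simp
    then show ?thesis
      using mult_left_mono[OF killed_ge[of u], of s] s by (simp add: ip_lazy algebra_simps)
  qed
  define w where "w = lazy s f"
  have sym: "ip u (lazy s v) = ip (lazy s u) v" for u v
    by (simp add: ip_lazy killed_selfadjoint ip_commute[of _ v])
  define r where "r = 1 / q"
  have "lazy s (\<lambda>x. f x - r * w x) = (\<lambda>x. w x - r * lazy s w x)"
    unfolding w_def by (rule lazy_diff)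
  then have "0 \<le> ip (\<lambda>x. f x - r * w x) (\<lambda>x. w x - r * lazy s w x)"
    using form_nonneg by metis
  also have "\<dots> = ip f w - 2 * r * ip w w + r\<^sup>2 * ip w (lazy s w)"
    by (simp add: ip_diff ip_diff' ip_scale ip_scale' sym[of f] power2_eq_square
        w_def[symmetric] algebra_simps)
  \<comment> \<open>\<open>form_le\<close> applies to \<open>w\<close> as well as to
    \<open>f\<close>, since \<open>lazy s\<close> preserves orthogonality to
    \<open>h\<close>.\<close>
  also have "\<dots> \<le> q * ip f f - 2 * r * ip w w + r\<^sup>2 * (q * ip w w)"
    using form_le[OF perp] form_le[of w] perp_lazy[OF perp]
    by (intro add_mono diff_right_mono mult_left_mono) (auto simp: w_def)
  also have "\<dots> = q * ip f f - ip w w / q"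
    using q by (simp add: r_def field_simps power2_eq_square)
  finally show ?thesis
    unfolding w_def[symmetric] q_def[symmetric] using q by (simp add: field_simps power2_eq_square)
qed

lemma lazy_power_contracts:
  assumes perp: "ip h f = 0" and s: "0 < s" "s \<le> 1 / 2" "s * g < 1"
  shows "ip h ((lazy s ^^ n) f) = 0"
    and "ip ((lazy s ^^ n) f) ((lazy s ^^ n) f) \<le> ((1 - s * g) ^ n)\<^sup>2 * ip f f"
proof -
  show *: "ip h ((lazy s ^^ n) f) = 0" for n
    by (induction n) (simp_all add: perp perp_lazy)
  show "ip ((lazy s ^^ n) f) ((lazy s ^^ n) f) \<le> ((1 - s * g) ^ n)\<^sup>2 * ip f f"
  proof (induction n)
    case (Suc n)
    have "ip ((lazy s ^^ Suc n) f) ((lazy s ^^ Suc n) f)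
        \<le> (1 - s * g)\<^sup>2 * ip ((lazy s ^^ n) f) ((lazy s ^^ n) f)"
      using lazy_contracts[OF * s] by simp
    also have "\<dots> \<le> (1 - s * g)\<^sup>2 * (((1 - s * g) ^ n)\<^sup>2 * ip f f)"
      using Suc by (intro mult_left_mono) auto
    finally show ?case by (simp add: power_mult_distrib mult_ac)
  qed simp
qed

lemma lazy_power_h: "x \<in> R \<Longrightarrow> (lazy s ^^ n) h x = (1 - \<phi> * s) ^ n * h x"
proof (induction n arbitrary: x)
  case (Suc n)
  \<comment> \<open>\<open>killed\<close> reads its argument on \<open>R\<close> alone, where the
    induction hypothesis holds.\<close>
  have "killed ((lazy s ^^ n) h) x = (1 - \<phi> * s) ^ n * killed h x"
    using killed_cong[of "(lazy s ^^ n) h" "\<lambda>x. (1 - \<phi> * s) ^ n * h x"] Suc.IH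
    by (simp add: killed_scale)
  moreover have "(lazy s ^^ Suc n) h x = (1 - s) * (lazy s ^^ n) h x + s * killed ((lazy s ^^ n) h) x"
    by (simp add: lazy_def[of s "(lazy s ^^ n) h"])
  ultimately show ?case
    by (simp only: Suc.IH[OF Suc.prems] h_eig[OF Suc.prems]) (simp add: algebra_simps)
qed simp

text \<open>For \<open>y\<close> in \<open>R\<close>, the coefficient
  \<open>ip h (indicator {y}) / ip h h\<close> of the orthogonal projection of
  \<open>indicator {y}\<close> on \<open>h\<close>.\<close>

definition weight :: "'a \<Rightarrow> real" where
  "weight y = m y * h y / ip h h"

text \<open>Split \<open>indicator {y}\<close> into its projection on \<open>h\<close>, which
  evolves exactly by eigenvalue powers, and an orthogonal rest, which contracts in norm. Passing
  from the norm to the value at \<open>x\<close> costs \<open>1 / sqrt (m x)\<close> through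
  \<open>point_le_ip\<close>.\<close>

lemma lazy_power_indicator:
  assumes x: "x \<in> R" and y: "y \<in> R" and s: "0 < s" "s \<le> 1 / 2" "s * g < 1"
  shows "\<bar>(lazy s ^^ n) (indicator {y}) x - weight y * (1 - \<phi> * s) ^ n * h x\<bar>
    \<le> (1 - g * s) ^ n * sqrt (m y / m x)"
proof -
  define c where "c = weight y"
  define f where "f z = indicator {y} z - c * h z" for z
  have ip_ind: "ip u (indicator {y}) = m y * u y" for u
  proof -
    have "ip u (indicator {y}) = (\<Sum>x\<in>R. if x = y then m y * u y else 0)"
      unfolding ip_def by (intro sum.cong) (auto simp: indicator_def)
    then show ?thesis using y by simp
  qed
  have ch: "c * ip h h = m y * h y" using norm_h_pos by (simp add: c_def weight_def)
  have perp: "ip h f = 0"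
    unfolding f_def by (simp add: ip_diff ip_scale ip_ind ch)
  \<comment> \<open>By Pythagoras the rest has at most the squared norm of the indicator, which is
    \<open>m y\<close>.\<close>
  have "ip f f = ip f (indicator {y})"
  proof -
    have "ip f f = ip f (\<lambda>z. indicator {y} z - c * h z)" by (simp only: f_def[abs_def])
    also have "\<dots> = ip f (indicator {y}) - c * ip h f"
      by (simp only: ip_diff ip_scale ip_commute[of f h])
    finally show ?thesis by (simp add: perp)
  qed
  also have "\<dots> = m y - c * (c * ip h h)"
    unfolding ch by (simp add: ip_ind f_def algebra_simps)
  also have "\<dots> \<le> m y" using norm_h_pos by (simp add: mult.assoc[symmetric])
  finally have ff: "ip f f \<le> m y" .
  have "m x * ((lazy s ^^ n) f x)\<^sup>2 \<le> ip ((lazy s ^^ n) f) ((lazy s ^^ n) f)"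
    by (rule point_le_ip[OF x])
  also have "\<dots> \<le> ((1 - s * g) ^ n)\<^sup>2 * ip f f"
    by (rule lazy_power_contracts[OF perp s])
  also have "\<dots> \<le> ((1 - s * g) ^ n)\<^sup>2 * m y"
    by (intro mult_left_mono ff) auto
  finally have "((lazy s ^^ n) f x)\<^sup>2 \<le> ((1 - s * g) ^ n)\<^sup>2 * (m y / m x)"
    using m_pos[OF x] by (simp add: field_simps)
  then have "\<bar>(lazy s ^^ n) f x\<bar> \<le> sqrt (((1 - s * g) ^ n)\<^sup>2 * (m y / m x))"
    by (rule real_le_rsqrt[of "\<bar>_\<bar>", simplified])
  also have "\<dots> = (1 - g * s) ^ n * sqrt (m y / m x)"
    using s by (simp only: real_sqrt_mult real_sqrt_abs) (simp add: mult.commute[of s])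
  finally have "\<bar>(lazy s ^^ n) f x\<bar> \<le> (1 - g * s) ^ n * sqrt (m y / m x)" .
  moreover have "(lazy s ^^ n) (indicator {y}) x = c * ((1 - \<phi> * s) ^ n * h x) + (lazy s ^^ n) f x"
  proof -
    have "indicator {y} = (\<lambda>x. c * h x + f x)" by (simp add: f_def fun_eq_iff)
    then show ?thesis by (simp only: lazy_power_linear lazy_power_h[OF x])
  qed
  ultimately show ?thesis by (simp add: c_def mult.assoc)
qed

section \<open>From powers of the lazy operator to the killed semigroup\<close>

lemma killed_limit_approx:
  assumes x: "x \<in> R" and y: "y \<in> R" and t: "0 < t"
    and lim: "(\<lambda>n. (lazy (t / 2 ^ n) ^^ 2 ^ n) (indicator {y}) x) \<longlonglongrightarrow> Q"
  shows "\<bar>Q - weight y * exp (- \<phi> * t) * h x\<bar> \<le> exp (- g * t) * sqrt (m y / m x)"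
proof (rule tendsto_le)
  show "(\<lambda>n. \<bar>(lazy (t / 2 ^ n) ^^ 2 ^ n) (indicator {y}) x
      - weight y * (1 - \<phi> * (t / 2 ^ n)) ^ 2 ^ n * h x\<bar>)
    \<longlonglongrightarrow> \<bar>Q - weight y * exp (- \<phi> * t) * h x\<bar>"
    by (intro tendsto_intros lim one_minus_div_power_limit)
  show "(\<lambda>n. (1 - g * (t / 2 ^ n)) ^ 2 ^ n * sqrt (m y / m x)) \<longlonglongrightarrow> exp (- g * t) * sqrt (m y / m x)"
    by (intro tendsto_intros one_minus_div_power_limit)
  \<comment> \<open>The contraction asks for a step \<open>s \<le> 1 / 2\<close> with
    \<open>s * g < 1\<close>, which holds eventually.\<close>
  have "(\<lambda>n. t / 2 ^ n) \<longlonglongrightarrow> 0" by real_asymp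
  then have "\<forall>\<^sub>F n in sequentially. t / 2 ^ n < min (1 / 2) (1 / g)"
    using gap_pos by (intro order_tendstoD(2)) auto
  then show "\<forall>\<^sub>F n in sequentially. \<bar>(lazy (t / 2 ^ n) ^^ 2 ^ n) (indicator {y}) x
      - weight y * (1 - \<phi> * (t / 2 ^ n)) ^ 2 ^ n * h x\<bar>
    \<le> (1 - g * (t / 2 ^ n)) ^ 2 ^ n * sqrt (m y / m x)"
  proof eventually_elim
    case (elim n)
    then have "t / 2 ^ n < 1 / 2" "t / 2 ^ n < 1 / g" by auto
    moreover have "0 < t / 2 ^ n" using t by simp
    ultimately have "0 < t / 2 ^ n" "t / 2 ^ n \<le> 1 / 2" "t / 2 ^ n * g < 1"
      using gap_pos by (simp_all add: field_simps)
    from lazy_power_indicator[OF x y this] show ?case .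
  qed
qed simp

text \<open>The additive error \<open>exp (- g * t) * sqrt (m y / m x)\<close> becomes relative to
  the main term once \<open>sqrt (m y / m x)\<close> is bounded by
  \<open>m y * h y * h x / \<zeta>\<close>.\<close>

lemma relative_error:
  assumes x: "x \<in> R" and y: "y \<in> R" and t: "0 < t"
    and \<zeta>: "0 < \<zeta>" "\<And>z. z \<in> R \<Longrightarrow> \<zeta> \<le> m z * (h z)\<^sup>2"
    and lim: "(\<lambda>n. (lazy (t / 2 ^ n) ^^ 2 ^ n) (indicator {y}) x) \<longlonglongrightarrow> Q"
  shows "\<bar>Q - exp (- \<phi> * t) * h x / ip h h * (m y * h y)\<bar>
    \<le> exp (- (g - \<phi>) * t) * ip h h / \<zeta> * (exp (- \<phi> * t) * h x / ip h h * (m y * h y))"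
proof -
  have pos: "0 < m x" "0 < m y" "0 < h x" "0 < h y" "0 < ip h h"
    using x y by (auto simp: m_pos h_pos norm_h_pos)
  \<comment> \<open>Multiplying the bounds on \<open>\<zeta>\<close> at \<open>x\<close> and at
    \<open>y\<close> yields \<open>\<zeta> \<le> sqrt (m x * m y) * h x * h y\<close>, here in
    squared form.\<close>
  have "\<zeta>\<^sup>2 \<le> (m x * (h x)\<^sup>2) * (m y * (h y)\<^sup>2)"
    unfolding power2_eq_square[of \<zeta>] using \<zeta>(1) \<zeta>(2)[OF x] \<zeta>(2)[OF y] by (intro mult_mono) auto
  then have "\<zeta>\<^sup>2 * (m y / m x) \<le> (m x * (h x)\<^sup>2) * (m y * (h y)\<^sup>2) * (m y / m x)"
    using pos by (intro mult_right_mono) auto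
  also have "\<dots> = (m y * h y * h x)\<^sup>2"
    using pos by (simp add: power_mult_distrib power2_eq_square)
  also have "\<zeta>\<^sup>2 * (m y / m x) = (\<zeta> * sqrt (m y / m x))\<^sup>2"
    using pos by (simp add: power_mult_distrib)
  finally have "(\<zeta> * sqrt (m y / m x))\<^sup>2 \<le> (m y * h y * h x)\<^sup>2" .
  then have "\<zeta> * sqrt (m y / m x) \<le> m y * h y * h x"
    by (rule power2_le_imp_le) (use pos in simp)
  then have "sqrt (m y / m x) \<le> m y * h y * h x / \<zeta>"
    using \<zeta>(1) by (simp add: le_divide_eq mult.commute)
  then have "exp (- g * t) * sqrt (m y / m x) \<le> exp (- g * t) * (m y * h y * h x / \<zeta>)"
    by (intro mult_left_mono) auto
  also have "\<dots> = exp (- (g - \<phi>) * t) * ip h h / \<zeta> * (exp (- \<phi> * t) * h x / ip h h * (m y * h y))"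
  proof -
    have "exp (- g * t) = exp (- (g - \<phi>) * t) * exp (- \<phi> * t)"
      by (simp add: exp_add[symmetric] algebra_simps)
    then show ?thesis using pos by (simp only:) (simp add: mult_ac)
  qed
  finally have "exp (- g * t) * sqrt (m y / m x)
    \<le> exp (- (g - \<phi>) * t) * ip h h / \<zeta> * (exp (- \<phi> * t) * h x / ip h h * (m y * h y))" .
  moreover have "weight y * exp (- \<phi> * t) * h x = exp (- \<phi> * t) * h x / ip h h * (m y * h y)"
    by (simp add: weight_def)
  ultimately show ?thesis
    using killed_limit_approx[OF x y t lim] by linarith
qed

end

section \<open>Survival probabilities of the process\<close>

lemma generator_power_bound:
  fixes p :: "'a::finite \<Rightarrow> 'a \<Rightarrow> real"
  assumes p: "stochastic_kernel p" and f: "\<And>x. \<bar>f x\<bar> \<le> M"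
  shows "\<bar>(generator p ^^ n) f x\<bar> \<le> 2 ^ n * M"
proof (induction n arbitrary: x)
  case (Suc n)
  define u where "u = (generator p ^^ n) f"
  \<comment> \<open>The generator at most doubles a bound: increments are at most twice the bound,
    and rows of \<open>p\<close> sum to one.\<close>
  have "\<bar>p x y * (u y - u x)\<bar> \<le> p x y * (2 * (2 ^ n * M))" for y
    using Suc.IH[of x] Suc.IH[of y] p
    by (auto simp: abs_mult stochastic_kernel_def u_def intro!: mult_left_mono)
  then have "\<bar>generator p u x\<bar> \<le> (\<Sum>y\<in>UNIV. p x y * (2 * (2 ^ n * M)))"
    unfolding generator_def by (intro sum_abs[THEN order_trans] sum_mono)
  also have "\<dots> = 2 ^ Suc n * M"
    using p by (simp add: sum_distrib_right[symmetric] stochastic_kernel_def)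
  finally show ?case by (simp add: u_def)
qed (simp add: f)

text \<open>The series is dominated termwise by that of \<open>exp (2 * s)\<close>, so its tail from
  the second order on is at most \<open>exp (2 * s) - 1 - 2 * s\<close>.\<close>

lemma transition_prob_first_order:
  fixes p :: "'a::finite \<Rightarrow> 'a \<Rightarrow> real"
  assumes p: "stochastic_kernel p" and s: "0 \<le> s" "s \<le> 1 / 2"
  shows "\<bar>transition_prob p s x y - (indicator {y} x + s * generator p (indicator {y}) x)\<bar> \<le> 4 * s\<^sup>2"
proof -
  define a where "a n = s ^ n / fact n * (generator p ^^ n) (indicator {y}) x" for n
  define b where "b n = (2 * s) ^ n / fact n" for n :: nat
  have "\<bar>(generator p ^^ n) (indicator {y}) x\<bar> \<le> 2 ^ n" for n
    using generator_power_bound[OF p, of "indicator {y}" 1] by (simp add: indicator_def)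
  then have "s ^ n / fact n * \<bar>(generator p ^^ n) (indicator {y}) x\<bar> \<le> s ^ n / fact n * 2 ^ n" for n
    using s by (intro mult_left_mono) auto
  then have ab: "norm (a n) \<le> b n" for n
    using s by (simp add: a_def b_def abs_mult power_mult_distrib mult_ac)
  have "b = (\<lambda>n. (2 * s) ^ n /\<^sub>R fact n)"
    by (simp add: b_def fun_eq_iff field_simps)
  then have bsum: "b sums exp (2 * s)" by (simp only: exp_converges)
  then have bs: "summable b" by (simp add: sums_iff)
  then have as: "summable a" by (rule summable_comparison_test') (rule ab)
  have split: "suminf c = c 0 + c 1 + (\<Sum>n. c (n + 2))" if "summable c" for c :: "nat \<Rightarrow> real"
    using suminf_split_initial_segment[OF that, of 2] by (simp add: numeral_2_eq_2)
  have "\<bar>\<Sum>n. a (n + 2)\<bar> \<le> (\<Sum>n. b (n + 2))"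
    using norm_suminf_le[OF ab summable_ignore_initial_segment[OF bs]] by (simp only: real_norm_def)
  also have "\<dots> = exp (2 * s) - 1 - 2 * s"
    using split[OF bs] bsum by (simp add: sums_iff b_def)
  \<comment> \<open>\<open>exp_bound\<close> is \<open>exp u \<le> 1 + u + u\<^sup>2\<close> for
    \<open>u\<close> in the unit interval; with \<open>u = 2 * s\<close> this is where
    \<open>s \<le> 1 / 2\<close> enters.\<close>
  also have "\<dots> \<le> 4 * s\<^sup>2"
    using exp_bound[of "2 * s"] s by (simp add: power_mult_distrib)
  finally have "\<bar>\<Sum>n. a (n + 2)\<bar> \<le> 4 * s\<^sup>2" .
  moreover have "transition_prob p s x y = a 0 + a 1 + (\<Sum>n. a (n + 2))"
  proof -
    have "transition_prob p s x y = suminf a" by (simp add: transition_prob_def a_def[abs_def])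
    then show ?thesis using split[OF as] by simp
  qed
  moreover have "a 0 + a 1 = indicator {y} x + s * generator p (indicator {y}) x"
    by (simp add: a_def)
  ultimately show ?thesis by simp
qed

text \<open>One step of a chain with kernel \<open>T\<close> killed outside \<open>R\<close>. With
  \<open>T = transition_prob p s\<close> it describes the exact skeleton of the process.\<close>

definition killed_step :: "('a \<Rightarrow> 'a \<Rightarrow> real) \<Rightarrow> 'a set \<Rightarrow> ('a \<Rightarrow> real) \<Rightarrow> 'a \<Rightarrow> real" where
  "killed_step T R f w = (\<Sum>v\<in>R. T w v * f v)"

text \<open>Because rows of \<open>p\<close> sum to one, \<open>lazy s\<close> on \<open>R\<close>
  is a killed step for the first-order kernel \<open>1 + s L\<close>, with
  \<open>L = generator p\<close>, so it can be compared with the exact skeleton entry by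
  entry.\<close>

lemma (in killed_kernel) lazy_eq_sum:
  assumes w: "w \<in> R"
  shows "lazy s f w = (\<Sum>v\<in>R. (indicator {v} w + s * generator p (indicator {v}) w) * f v)"
proof -
  have gen: "generator p (indicator {v}) w = p w v - indicator {v} w" for v
  proof -
    have "generator p (indicator {v}) w
        = (\<Sum>y\<in>UNIV. p w y * indicator {v} y) - indicator {v} w * (\<Sum>y\<in>UNIV. p w y)"
      by (simp add: generator_def right_diff_distrib sum_subtractf sum_distrib_left mult.commute)
    also have "(\<Sum>y\<in>UNIV. p w y * indicator {v} y) = p w v"
      by (simp add: indicator_def)
    finally show ?thesis by (simp add: p_sum)
  qed
  have "(\<Sum>v\<in>R. indicator {v} w * f v) = f w"
    using w by (simp add: indicator_def if_distrib[of "\<lambda>x. x * _"] cong: if_cong)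
  moreover have "(\<Sum>v\<in>R. (d v + s * (p w v - d v)) * f v)
      = (1 - s) * (\<Sum>v\<in>R. d v * f v) + s * killed f w" for d
    by (simp add: killed_def sum_distrib_left sum.distrib[symmetric] algebra_simps)
  ultimately show ?thesis by (simp add: gen lazy_def)
qed

text \<open>Neither operator increases bounds on \<open>R\<close>, so the errors of the
  \<open>N\<close> steps merely add up, each at most \<open>card R * e\<close>.\<close>

lemma (in killed_kernel) killed_step_power_close:
  assumes s: "0 \<le> s" "s \<le> 1"
    and T: "\<And>w v. 0 \<le> T w v" "\<And>w. (\<Sum>v\<in>R. T w v) \<le> 1"
    and close: "\<And>w v. \<bar>T w v - (indicator {v} w + s * generator p (indicator {v}) w)\<bar> \<le> e"
    and f: "\<And>w. w \<in> R \<Longrightarrow> \<bar>f w\<bar> \<le> 1" and x: "x \<in> R"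
  shows "\<bar>(killed_step T R ^^ N) f x - (lazy s ^^ N) f x\<bar> \<le> real N * (real (card R) * e)"
  using x
proof (induction N arbitrary: x)
  case (Suc N)
  define u where "u = (killed_step T R ^^ N) f"
  define v where "v = (lazy s ^^ N) f"
  have e: "0 \<le> e" using close[of x x] by simp
  have "\<bar>killed_step T R u x - killed_step T R v x\<bar> \<le> (\<Sum>w\<in>R. T x w * (real N * (real (card R) * e)))"
    unfolding killed_step_def sum_subtractf[symmetric] right_diff_distrib[symmetric]
    by (intro sum_abs[THEN order_trans] sum_mono)
      (auto simp: abs_mult T u_def v_def intro!: mult_left_mono Suc.IH)
  also have "\<dots> \<le> 1 * (real N * (real (card R) * e))"
    unfolding sum_distrib_right[symmetric] using e by (intro mult_right_mono T) auto
  finally have 1: "\<bar>killed_step T R u x - killed_step T R v x\<bar> \<le> real N * (real (card R) * e)"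
    by simp
  have "\<bar>killed_step T R v x - lazy s v x\<bar>
      \<le> (\<Sum>w\<in>R. \<bar>T x w - (indicator {w} x + s * generator p (indicator {w}) x)\<bar> * \<bar>v w\<bar>)"
    unfolding lazy_eq_sum[OF Suc.prems] killed_step_def sum_subtractf[symmetric]
      left_diff_distrib[symmetric]
    by (intro sum_abs[THEN order_trans] sum_mono) (auto simp: abs_mult)
  also have "\<dots> \<le> (\<Sum>w\<in>R. e * 1)"
    unfolding v_def using e
    by (intro sum_mono mult_mono close lazy_power_abs_le s f) auto
  finally have 2: "\<bar>killed_step T R v x - lazy s v x\<bar> \<le> real (card R) * e" by simp
  have "\<bar>killed_step T R u x - lazy s v x\<bar> \<le> real (Suc N) * (real (card R) * e)"
    using 1 2 by (simp add: algebra_simps)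
  then show ?case by (simp add: u_def v_def)
qed simp

section \<open>The process observed on a time grid\<close>

context
  fixes p :: "'a::finite \<Rightarrow> 'a \<Rightarrow> real" and P :: "'a \<Rightarrow> 'w measure" and X :: "real \<Rightarrow> 'w \<Rightarrow> 'a"
  assumes markov: "markov_process p P X"
begin

lemma process_prob_space: "prob_space (P x)"
  using markov by (simp add: markov_process_def)

lemma process_measurable: "0 \<le> t \<Longrightarrow> X t \<in> measurable (P x) (count_space UNIV)"
  using markov by (simp add: markov_process_def)

lemma process_right_continuous:
  "\<omega> \<in> space (P x) \<Longrightarrow> 0 \<le> t \<Longrightarrow> \<forall>\<^sub>F u in at_right t. X u \<omega> = X t \<omega>"
  using markov by (simp add: markov_process_def)

lemma process_path_prob:
  assumes "0 \<le> s"
  shows "\<P>(\<omega> in P x. \<forall>i\<le>n. X (real i * s) \<omega> = z i) =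
    (if z 0 = x then \<Prod>i<n. transition_prob p s (z i) (z (Suc i)) else 0)"
proof -
  have "\<forall>x n \<sigma> z. \<sigma> 0 = 0 \<longrightarrow> (\<forall>i<n. \<sigma> i \<le> \<sigma> (Suc i)) \<longrightarrow>
        \<P>(\<omega> in P x. \<forall>i\<le>n. X (\<sigma> i) \<omega> = z i) =
        (if z 0 = x then \<Prod>i<n. transition_prob p (\<sigma> (Suc i) - \<sigma> i) (z i) (z (Suc i)) else 0)"
    using markov by (simp add: markov_process_def)
  from this[rule_format, of "\<lambda>i. real i * s" n x z] show ?thesis
    using assms by (simp add: algebra_simps)
qed

lemma process_start: "AE \<omega> in P x. X 0 \<omega> = x"
proof -
  interpret prob_space "P x" by (rule process_prob_space)
  have [measurable]: "X 0 \<in> measurable (P x) (count_space UNIV)" by (rule process_measurable) simp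
  have "\<P>(\<omega> in P x. X 0 \<omega> = x) = 1"
    using process_path_prob[of 0 x 0 "\<lambda>_. x"] by simp
  then show ?thesis by (subst (asm) prob_Collect_eq_1) auto
qed

text \<open>Identifies the exponential series with a probability; nonnegativity and row sums at most
  one are read off from this rather than from the series.\<close>

lemma process_transition_prob:
  assumes "0 \<le> s"
  shows "\<P>(\<omega> in P x. X s \<omega> = y) = transition_prob p s x y"
proof -
  interpret prob_space "P x" by (rule process_prob_space)
  have [measurable]: "X 0 \<in> measurable (P x) (count_space UNIV)" "X s \<in> measurable (P x) (count_space UNIV)"
    using assms by (auto intro: process_measurable)
  have "\<P>(\<omega> in P x. X s \<omega> = y) = \<P>(\<omega> in P x. \<forall>i\<le>(1::nat). X (real i * s) \<omega> = (if i = 0 then x else y))"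
  proof (rule prob_eq_AE)
    show "AE \<omega> in P x. (X s \<omega> = y) = (\<forall>i\<le>(1::nat). X (real i * s) \<omega> = (if i = 0 then x else y))"
      using process_start[of x] by eventually_elim (auto simp: le_Suc_eq)
    have "{\<omega> \<in> space (P x). \<forall>i\<le>(1::nat). X (real i * s) \<omega> = (if i = 0 then x else y)}
       = {\<omega> \<in> space (P x). X 0 \<omega> = x \<and> X s \<omega> = y}"
      by (auto simp: le_Suc_eq)
    then show "{\<omega> \<in> space (P x). \<forall>i\<le>(1::nat). X (real i * s) \<omega> = (if i = 0 then x else y)} \<in> sets (P x)"
      by simp
  qed simp
  then show ?thesis using process_path_prob[OF assms, of x 1] by simp
qed

lemma transition_prob_nonneg: "0 \<le> s \<Longrightarrow> 0 \<le> transition_prob p s x y"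
  by (metis measure_nonneg process_transition_prob)

lemma transition_prob_sum_le: "0 \<le> s \<Longrightarrow> (\<Sum>y\<in>R. transition_prob p s x y) \<le> 1"
proof -
  assume s: "0 \<le> s"
  interpret prob_space "P x" by (rule process_prob_space)
  have [measurable]: "X s \<in> measurable (P x) (count_space UNIV)"
    using s by (rule process_measurable)
  have "(\<Sum>y\<in>R. transition_prob p s x y) = (\<Sum>y\<in>R. prob {\<omega> \<in> space (P x). X s \<omega> = y})"
    using s by (simp add: process_transition_prob)
  also have "\<dots> = prob (\<Union>y\<in>R. {\<omega> \<in> space (P x). X s \<omega> = y})"
    by (intro finite_measure_finite_Union[symmetric]) (auto simp: disjoint_family_on_def)
  finally show ?thesis by simp
qed

text \<open>For the induction on \<open>k\<close> the first \<open>n\<close> steps are prescribed by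
  \<open>z\<close>, and each step moves the next position in \<open>R\<close> into this prefix. The
  lemma is applied with \<open>n = 0\<close>.\<close>

lemma process_skeleton_prob:
  assumes s: "0 \<le> s" and z0: "z 0 = x"
  shows "\<P>(\<omega> in P x. (\<forall>i\<le>n. X (real i * s) \<omega> = z i) \<and>
      (\<forall>j<k. X (real (n + Suc j) * s) \<omega> \<in> R) \<and> X (real (n + k) * s) \<omega> = v) =
    (\<Prod>i<n. transition_prob p s (z i) (z (Suc i))) *
      (killed_step (transition_prob p s) R ^^ k) (indicator {v}) (z n)"
  using z0
proof (induction k arbitrary: n z)
  case 0
  show ?case
  proof (cases "z n = v")
    case True
    then have "{\<omega> \<in> space (P x). (\<forall>i\<le>n. X (real i * s) \<omega> = z i) \<and>
        (\<forall>j<0. X (real (n + Suc j) * s) \<omega> \<in> R) \<and> X (real (n + 0) * s) \<omega> = v}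
      = {\<omega> \<in> space (P x). \<forall>i\<le>n. X (real i * s) \<omega> = z i}" by auto
    then show ?thesis using process_path_prob[OF s, of x n z] 0 True by simp
  next
    case False
    then have "{\<omega> \<in> space (P x). (\<forall>i\<le>n. X (real i * s) \<omega> = z i) \<and>
        (\<forall>j<0. X (real (n + Suc j) * s) \<omega> \<in> R) \<and> X (real (n + 0) * s) \<omega> = v} = {}" by auto
    then show ?thesis using False by (simp only: measure_empty) simp
  qed
next
  case (Suc k)
  interpret prob_space "P x" by (rule process_prob_space)
  have [measurable]: "X (real i * s) \<in> measurable (P x) (count_space UNIV)" for i
    using s by (intro process_measurable) simp
  define z' where "z' w = z(Suc n := w)" for w
  define A where "A w = {\<omega> \<in> space (P x). (\<forall>i\<le>Suc n. X (real i * s) \<omega> = z' w i) \<and>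
      (\<forall>j<k. X (real (Suc n + Suc j) * s) \<omega> \<in> R) \<and> X (real (Suc n + k) * s) \<omega> = v}" for w
  \<comment> \<open>Stated for any sequence \<open>Y\<close>: the position at index
    \<open>n + 1\<close> is singled out as the witness \<open>w\<close>.\<close>
  have "((\<forall>i\<le>n. Y i = z i) \<and> (\<forall>j<Suc k. Y (n + Suc j) \<in> R) \<and> Y (n + Suc k) = v) \<longleftrightarrow>
      (\<exists>w\<in>R. (\<forall>i\<le>Suc n. Y i = z' w i) \<and> (\<forall>j<k. Y (Suc n + Suc j) \<in> R) \<and> Y (Suc n + k) = v)"
    for Y :: "nat \<Rightarrow> 'a"
  proof -
    have "(\<forall>j<Suc k. Y (n + Suc j) \<in> R) \<longleftrightarrow> Y (Suc n) \<in> R \<and> (\<forall>j<k. Y (Suc n + Suc j) \<in> R)"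
      by (simp only: All_less_Suc2) simp
    moreover have "(\<forall>i\<le>Suc n. Y i = z' w i) \<longleftrightarrow> (\<forall>i\<le>n. Y i = z i) \<and> Y (Suc n) = w" for w
      by (auto simp: z'_def le_Suc_eq)
    ultimately show ?thesis by simp
  qed
  note split = this[of "\<lambda>i. X (real i * s) \<omega>" for \<omega>]
  have unions: "(\<Union>w\<in>R. {\<omega> \<in> space (P x). B w \<omega>}) = {\<omega> \<in> space (P x). \<exists>w\<in>R. B w \<omega>}" for B by blast
  have "{\<omega> \<in> space (P x). (\<forall>i\<le>n. X (real i * s) \<omega> = z i) \<and>
      (\<forall>j<Suc k. X (real (n + Suc j) * s) \<omega> \<in> R) \<and> X (real (n + Suc k) * s) \<omega> = v} = (\<Union>w\<in>R. A w)"
    unfolding A_def split unions ..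
  moreover have "prob (\<Union>w\<in>R. A w) = (\<Sum>w\<in>R. prob (A w))"
  proof (rule finite_measure_finite_Union)
    have "A w \<in> sets (P x)" for w unfolding A_def by measurable
    then show "A ` R \<subseteq> sets (P x)" by blast
    have "X (real (Suc n) * s) \<omega> = w" if "\<omega> \<in> A w" for \<omega> w
      using that[unfolded A_def mem_Collect_eq] by (metis fun_upd_same order_refl z'_def)
    then show "disjoint_family_on A R"
      unfolding disjoint_family_on_def by blast
  qed simp
  moreover have "prob (A w) = (\<Prod>i<n. transition_prob p s (z i) (z (Suc i))) *
      (transition_prob p s (z n) w *
        (killed_step (transition_prob p s) R ^^ k) (indicator {v}) w)" for w
    using Suc.IH[of "z' w" "Suc n"] Suc.prems unfolding A_def by (simp add: z'_def mult.assoc)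
  moreover have "(killed_step (transition_prob p s) R ^^ Suc k) (indicator {v}) (z n) =
      (\<Sum>w\<in>R. transition_prob p s (z n) w *
        (killed_step (transition_prob p s) R ^^ k) (indicator {v}) w)"
    by (simp add: killed_step_def[of _ _ "(killed_step _ _ ^^ k) _"])
  ultimately show ?case
    by (simp only: sum_distrib_left[symmetric])
qed

text \<open>A path is constant just to the right of each time and dyadic points are dense, so an
  exit from \<open>R\<close> before \<open>t\<close> is seen on some grid. At \<open>t\<close>
  right-continuity keeps the path in \<open>R\<close> a little longer, which makes the inequality
  strict.\<close>

lemma hitting_time_gt_iff:
  assumes \<omega>: "\<omega> \<in> space (P x)" and t: "0 < t"
  shows "hitting_time X (- R) \<omega> > ereal t \<longleftrightarrow> (\<forall>n. \<forall>k\<le>2 ^ n. X (real k * (t / 2 ^ n)) \<omega> \<in> R)"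
proof
  assume gt: "hitting_time X (- R) \<omega> > ereal t"
  have "X u \<omega> \<in> R" if "0 \<le> u" "u \<le> t" for u
  proof (rule ccontr)
    assume "X u \<omega> \<notin> R"
    then have "hitting_time X (- R) \<omega> \<le> ereal u"
      unfolding hitting_time_def using that by (intro Inf_lower) auto
    with gt \<open>u \<le> t\<close> show False by (metis ereal_less_eq(3) leD order_trans)
  qed
  moreover have "real k * (t / 2 ^ n) \<le> t" if "k \<le> 2 ^ n" for k n :: nat
  proof -
    have "real k \<le> 2 ^ n" using that by (metis of_nat_le_iff of_nat_numeral of_nat_power)
    then show ?thesis using t by (simp add: field_simps)
  qed
  ultimately show "\<forall>n. \<forall>k\<le>2 ^ n. X (real k * (t / 2 ^ n)) \<omega> \<in> R"
    using t by simp
next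
  assume grid: "\<forall>n. \<forall>k\<le>2 ^ n. X (real k * (t / 2 ^ n)) \<omega> \<in> R"
  have Xt: "X t \<omega> \<in> R" using grid[rule_format, of 1 0] by simp
  have inside: "X u \<omega> \<in> R" if u: "0 \<le> u" "u < t" for u
  proof -
    obtain b where b: "u < b" "\<And>v. u < v \<Longrightarrow> v < b \<Longrightarrow> X v \<omega> = X u \<omega>"
      using process_right_continuous[OF \<omega> u(1)] unfolding eventually_at_right_field by blast
    \<comment> \<open>On the window of length \<open>d\<close> to the right of \<open>u\<close> the
      path keeps its value and time stays below \<open>t\<close>.\<close>
    define d where "d = min b t - u"
    have d: "0 < d" using b u by (simp add: d_def)
    obtain n where n: "t / d < 2 ^ n" using real_arch_pow[of 2 "t / d"] by auto
    \<comment> \<open>The first grid point strictly after \<open>u\<close>: the successor of the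
      floor works also when \<open>u\<close> itself lies on the grid.\<close>
    define k where "k = Suc (nat \<lfloor>u * 2 ^ n / t\<rfloor>)"
    have "u * 2 ^ n / t < real k" "real k \<le> u * 2 ^ n / t + 1"
    proof -
      have "0 \<le> \<lfloor>u * 2 ^ n / t\<rfloor>" using u t by simp
      then have "real k = of_int \<lfloor>u * 2 ^ n / t\<rfloor> + 1" by (simp add: k_def)
      then show "u * 2 ^ n / t < real k" "real k \<le> u * 2 ^ n / t + 1" by linarith+
    qed
    then have lo: "u < real k * (t / 2 ^ n)" and "real k * (t / 2 ^ n) \<le> u + t / 2 ^ n"
      using t by (simp_all add: field_simps)
    moreover have "t / 2 ^ n < d" using n d by (simp add: field_simps)
    ultimately have "real k * (t / 2 ^ n) < u + d" by linarith
    then have hi: "real k * (t / 2 ^ n) < min b t" by (simp only: d_def)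
    then have "real k < 2 ^ n" using t by (simp add: field_simps)
    then have "k \<le> 2 ^ n" by (metis less_imp_le of_nat_le_iff of_nat_numeral of_nat_power)
    with grid have "X (real k * (t / 2 ^ n)) \<omega> \<in> R" by blast
    with b(2)[OF lo] hi show ?thesis by simp
  qed
  obtain b where b: "t < b" "\<And>v. t < v \<Longrightarrow> v < b \<Longrightarrow> X v \<omega> = X t \<omega>"
    using process_right_continuous[OF \<omega>, of t] t unfolding eventually_at_right_field by auto
  have "b \<le> u" if "0 \<le> u" "X u \<omega> \<in> - R" for u
    using that inside[of u] Xt b(2)[of u] by (metis ComplD linorder_less_linear not_le)
  then have "ereal b \<le> hitting_time X (- R) \<omega>"
    unfolding hitting_time_def by (intro Inf_greatest) auto
  with b(1) show "hitting_time X (- R) \<omega> > ereal t"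
    by (metis ereal_less_eq(3) leD leI order_trans)
qed

text \<open>The infimum over all times is replaced by countably many grid conditions.\<close>

lemma survival_event_measurable:
  assumes t: "0 < t"
  shows "{\<omega> \<in> space (P x). hitting_time X (- R) \<omega> > ereal t} \<in> sets (P x)"
proof -
  have [measurable]: "X (real k * (t / 2 ^ n)) \<in> measurable (P x) (count_space UNIV)" for k n
    using t by (intro process_measurable) simp
  have "{\<omega> \<in> space (P x). hitting_time X (- R) \<omega> > ereal t}
      = {\<omega> \<in> space (P x). \<forall>n. \<forall>k\<le>2 ^ n. X (real k * (t / 2 ^ n)) \<omega> \<in> R}"
    using hitting_time_gt_iff[OF _ t] by blast
  also have "\<dots> \<in> sets (P x)" by measurable
  finally show ?thesis .
qed

text \<open>The events \<open>A n\<close> of staying in \<open>R\<close> on the \<open>n\<close>-th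
  grid and ending at \<open>y\<close> decrease to the target event, up to the null event of not
  starting at \<open>x\<close>; continuity from above gives the limit.\<close>

lemma survival_prob_limit:
  assumes t: "0 < t" and x: "x \<in> R"
  shows "(\<lambda>n. (killed_step (transition_prob p (t / 2 ^ n)) R ^^ 2 ^ n) (indicator {y}) x)
    \<longlonglongrightarrow> \<P>(\<omega> in P x. X t \<omega> = y \<and> hitting_time X (- R) \<omega> > ereal t)"
proof -
  interpret prob_space "P x" by (rule process_prob_space)
  have X [measurable]: "X (real k * (t / 2 ^ n)) \<in> measurable (P x) (count_space UNIV)" for k n
    using t by (intro process_measurable) simp
  have [measurable]: "X t \<in> measurable (P x) (count_space UNIV)" "X 0 \<in> measurable (P x) (count_space UNIV)"
    using X[of 1 0] X[of 0 0] by simp_all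
  define A where "A n = {\<omega> \<in> space (P x). X 0 \<omega> = x \<and>
      (\<forall>k\<le>2 ^ n. X (real k * (t / 2 ^ n)) \<omega> \<in> R) \<and> X t \<omega> = y}" for n :: nat
  have "prob (A n) = (killed_step (transition_prob p (t / 2 ^ n)) R ^^ 2 ^ n) (indicator {y}) x" for n
  proof -
    \<comment> \<open>Index \<open>0\<close> is dropped, as the start \<open>x\<close> lies in
      \<open>R\<close>; this matches \<open>process_skeleton_prob\<close>.\<close>
    have "(\<forall>k\<le>2 ^ n. X (real k * (t / 2 ^ n)) \<omega> \<in> R) \<longleftrightarrow> (\<forall>j<2 ^ n. X (real (Suc j) * (t / 2 ^ n)) \<omega> \<in> R)"
      if "X 0 \<omega> = x" for \<omega>
    proof
      assume *: "\<forall>j<2 ^ n. X (real (Suc j) * (t / 2 ^ n)) \<omega> \<in> R"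
      show "\<forall>k\<le>2 ^ n. X (real k * (t / 2 ^ n)) \<omega> \<in> R"
      proof (intro allI impI)
        fix k :: nat assume "k \<le> 2 ^ n"
        then show "X (real k * (t / 2 ^ n)) \<omega> \<in> R"
          using * that x by (cases k) auto
      qed
    next
      assume *: "\<forall>k\<le>2 ^ n. X (real k * (t / 2 ^ n)) \<omega> \<in> R"
      show "\<forall>j<2 ^ n. X (real (Suc j) * (t / 2 ^ n)) \<omega> \<in> R"
        using *[rule_format, OF Suc_leI] by blast
    qed
    moreover have "(\<forall>i\<le>0. X (real i * (t / 2 ^ n)) \<omega> = x) \<longleftrightarrow> X 0 \<omega> = x" for \<omega> by simp
    moreover have "X (real (0 + 2 ^ n) * (t / 2 ^ n)) \<omega> = X t \<omega>" for \<omega> by simp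
    ultimately have "A n = {\<omega> \<in> space (P x). (\<forall>i\<le>0. X (real i * (t / 2 ^ n)) \<omega> = x) \<and>
        (\<forall>j<2 ^ n. X (real (0 + Suc j) * (t / 2 ^ n)) \<omega> \<in> R) \<and>
        X (real (0 + 2 ^ n) * (t / 2 ^ n)) \<omega> = y}"
      unfolding A_def by (simp only: add_0) blast
    moreover have "0 \<le> t / 2 ^ n" using t by simp
    note process_skeleton_prob[of "t / 2 ^ n" "\<lambda>_. x" x 0 "2 ^ n" R y, OF this refl]
    ultimately have "prob (A n) = (\<Prod>i<(0::nat). transition_prob p (t / 2 ^ n) x x) *
        (killed_step (transition_prob p (t / 2 ^ n)) R ^^ 2 ^ n) (indicator {y}) x"
      by (simp only:)
    then show ?thesis by simp
  qed
  moreover have "(\<lambda>n. prob (A n)) \<longlonglongrightarrow> prob (\<Inter>n. A n)"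
  proof (rule finite_Lim_measure_decseq)
    have "A n \<in> sets (P x)" for n unfolding A_def by measurable
    then show "range A \<subseteq> sets (P x)" by blast
    show "decseq A"
    proof (rule decseq_SucI, rule subsetI)
      fix n \<omega> assume \<omega>: "\<omega> \<in> A (Suc n)"
      have fine: "\<forall>k\<le>2 ^ Suc n. X (real k * (t / 2 ^ Suc n)) \<omega> \<in> R"
        using \<omega> unfolding A_def by blast
      have "X (real k * (t / 2 ^ n)) \<omega> \<in> R" if "k \<le> 2 ^ n" for k
      proof -
        \<comment> \<open>Each grid contains the coarser one by doubling indices.\<close>
        have "real (2 * k) * (t / 2 ^ Suc n) = real k * (t / 2 ^ n)" by simp
        moreover have "2 * k \<le> 2 ^ Suc n" using that by simp
        ultimately show ?thesis using fine by metis
      qed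
      with \<omega> show "\<omega> \<in> A n" unfolding A_def by blast
    qed
  qed
  moreover have "prob (\<Inter>n. A n) = \<P>(\<omega> in P x. X t \<omega> = y \<and> hitting_time X (- R) \<omega> > ereal t)"
  proof -
    have "(\<Inter>n. A n) = {\<omega> \<in> space (P x). X 0 \<omega> = x \<and> X t \<omega> = y \<and> hitting_time X (- R) \<omega> > ereal t}"
    proof (rule set_eqI)
      fix \<omega>
      show "\<omega> \<in> (\<Inter>n. A n) \<longleftrightarrow>
          \<omega> \<in> {\<omega> \<in> space (P x). X 0 \<omega> = x \<and> X t \<omega> = y \<and> hitting_time X (- R) \<omega> > ereal t}"
      proof (cases "\<omega> \<in> space (P x)")
        case True
        show ?thesis
          unfolding A_def INT_iff mem_Collect_eq hitting_time_gt_iff[OF True t] by fast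
      next
        case False
        then show ?thesis unfolding A_def INT_iff mem_Collect_eq by fast
      qed
    qed
    also have "prob \<dots> = \<P>(\<omega> in P x. X t \<omega> = y \<and> hitting_time X (- R) \<omega> > ereal t)"
      using process_start[of x] survival_event_measurable[OF t]
      by (intro prob_eq_AE) (auto intro!: sets.sets_Collect_conj)
    finally show ?thesis .
  qed
  ultimately show ?thesis by simp
qed

text \<open>Replaces the exact skeleton by Euler steps: \<open>2 ^ n\<close> of them, each with
  error of order \<open>(t / 2 ^ n)\<^sup>2\<close>, leave a total of order
  \<open>1 / 2 ^ n\<close>.\<close>

lemma killed_prob_limit:
  assumes "killed_kernel p m R" "stochastic_kernel p" and t: "0 < t" and x: "x \<in> R"
  shows "(\<lambda>n. (killed_kernel.lazy p R (t / 2 ^ n) ^^ 2 ^ n) (indicator {y}) x)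
    \<longlonglongrightarrow> \<P>(\<omega> in P x. X t \<omega> = y \<and> hitting_time X (- R) \<omega> > ereal t)"
proof -
  interpret killed_kernel p m R by fact
  define K where "K n = (killed_step (transition_prob p (t / 2 ^ n)) R ^^ 2 ^ n) (indicator {y}) x" for n :: nat
  define L where "L n = (lazy (t / 2 ^ n) ^^ 2 ^ n) (indicator {y}) x" for n :: nat
  have "(\<lambda>n. K n - L n) \<longlonglongrightarrow> 0"
  proof (rule Lim_null_comparison)
    have "(\<lambda>n. t / 2 ^ n) \<longlonglongrightarrow> 0" by real_asymp
    then have "\<forall>\<^sub>F n in sequentially. t / 2 ^ n < 1 / 2"
      by (intro order_tendstoD(2)) auto
    then show "\<forall>\<^sub>F n in sequentially. norm (K n - L n) \<le> 4 * t\<^sup>2 * real (card R) * (1 / 2 ^ n)"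
    proof eventually_elim
      case (elim n)
      have "\<bar>K n - L n\<bar> \<le> real (2 ^ n) * (real (card R) * (4 * (t / 2 ^ n)\<^sup>2))"
        unfolding K_def L_def using elim t x assms(2)
        by (intro killed_step_power_close transition_prob_first_order transition_prob_nonneg
            transition_prob_sum_le) (auto simp: indicator_def)
      also have "\<dots> = 4 * t\<^sup>2 * real (card R) * (1 / 2 ^ n)"
        by (simp add: power2_eq_square)
      finally show ?case by simp
    qed
    show "(\<lambda>n. 4 * t\<^sup>2 * real (card R) * (1 / 2 ^ n)) \<longlonglongrightarrow> 0" by real_asymp
  qed
  from tendsto_diff[OF survival_prob_limit[OF t x, of y, folded K_def] this]
  show ?thesis unfolding L_def by simp
qed

end

section \<open>The quasi-stationary measure\<close>

text \<open>Some state is charged, and detailed balance passes positivity along every edge, hence by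
  irreducibility to all states.\<close>

lemma reversible_irreducible_pos:
  assumes rev: "reversible p \<mu>" and irr: "irreducible_on UNIV p"
  shows "0 < pmf \<mu> x"
proof -
  obtain z where z: "0 < pmf \<mu> z"
    by (meson pmf_positive_iff set_pmf_not_empty equals0I)
  have "(z, x) \<in> {(u, v). u \<in> UNIV \<and> v \<in> UNIV \<and> p u v > 0}\<^sup>*"
    using irr by (simp add: irreducible_on_def)
  then show ?thesis
  proof induction
    case (step u v)
    then have "0 < pmf \<mu> u * p u v" by simp
    also have "\<dots> = pmf \<mu> v * p v u" using rev by (simp add: reversible_def)
    finally show ?case by (metis mult_zero_left pmf_nonneg less_le)
  qed (rule z)
qed

lemma killed_kernel_restricted_measure:
  fixes p :: "'a::finite \<Rightarrow> 'a \<Rightarrow> real"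
  assumes p: "stochastic_kernel p" and rev: "reversible p \<mu>"
    and pos: "\<And>x. 0 < pmf \<mu> x" and irr: "irreducible_on R (restricted_kernel p R)"
    and ne: "R \<noteq> {}"
  shows "killed_kernel p (pmf (restricted_measure \<mu> R)) R"
proof
  have int: "set_pmf \<mu> \<inter> R \<noteq> {}" using pos ne by (auto simp: pmf_positive_iff)
  have mR: "0 < measure_pmf.prob \<mu> R"
    using int by (simp add: measure_pmf_posI Int_commute) (metis IntE ex_in_conv int measure_pmf_posI)
  fix x y
  show "0 \<le> p x y" "(\<Sum>y\<in>UNIV. p x y) = 1" using p by (simp_all add: stochastic_kernel_def)
  show "0 < pmf (restricted_measure \<mu> R) x" if "x \<in> R"
    using that pos mR by (simp add: pmf_cond[OF int])
  show "(\<Sum>x\<in>R. pmf (restricted_measure \<mu> R) x) = 1"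
    by (intro sum_pmf_eq_1) (auto simp: set_cond_pmf[OF int])
  show "pmf (restricted_measure \<mu> R) x * p x y = pmf (restricted_measure \<mu> R) y * p y x"
    if "x \<in> R" "y \<in> R"
    using that rev by (simp add: pmf_cond[OF int] reversible_def)
  show "(x, y) \<in> {(u, v). u \<in> R \<and> v \<in> R \<and> p u v > 0}\<^sup>*" if "x \<in> R" "y \<in> R"
  proof -
    \<comment> \<open>The two kernels differ only on the diagonal, so an edge of the restricted
      kernel is an edge of \<open>p\<close> or a loop.\<close>
    have "{(u, v). u \<in> R \<and> v \<in> R \<and> restricted_kernel p R u v > 0}
        \<subseteq> {(u, v). u \<in> R \<and> v \<in> R \<and> p u v > 0}\<^sup>="
      by (auto simp: restricted_kernel_def split: if_splits)
    from rtrancl_mono[OF this] show ?thesis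
      using irr that by (auto simp: irreducible_on_def)
  qed
qed

locale killed_kernel_pmf = killed_kernel p "pmf (restricted_measure \<mu> R)" R
  for p :: "'a::finite \<Rightarrow> 'a \<Rightarrow> real" and \<mu> :: "'a pmf" and R :: "'a set" +
  assumes two_states: "2 \<le> card R"
    and restricted_support: "set_pmf (restricted_measure \<mu> R) \<subseteq> R"
begin

section \<open>The spectral gap as a positive Poincare constant\<close>

lemma dirichlet_form_eq: "dirichlet_form p \<mu> R f = energy f"
  unfolding dirichlet_form_def energy_def
  \<comment> \<open>Diagonal entries do not contribute, since \<open>f x - f y\<close> vanishes
    there.\<close>
  by (intro arg_cong[where f = "(*) (1 / 2)"] sum.cong) (auto simp: restricted_kernel_def)

lemma expectation_eq: "measure_pmf.expectation (restricted_measure \<mu> R) f = ip (\<lambda>_. 1) f"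
  using restricted_support
  by (subst integral_measure_pmf_real[of R]) (auto simp: ip_def mult.commute)

lemma variance_eq:
  "measure_pmf.variance (restricted_measure \<mu> R) f = ip f f - (ip (\<lambda>_. 1) f)\<^sup>2"
proof -
  have "measure_pmf.variance (restricted_measure \<mu> R) f
      = measure_pmf.expectation (restricted_measure \<mu> R) (\<lambda>x. (f x)\<^sup>2)
        - (measure_pmf.expectation (restricted_measure \<mu> R) f)\<^sup>2"
    by (intro measure_pmf.variance_eq integrable_measure_pmf_finite) simp_all
  then show ?thesis
    by (simp add: expectation_eq) (simp add: ip_def power2_eq_square mult.assoc)
qed

lemma variance_pos_iff:
  fixes f :: "'a \<Rightarrow> real"
  shows "measure_pmf.variance (restricted_measure \<mu> R) f \<noteq> 0 \<longleftrightarrow>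
   0 < measure_pmf.variance (restricted_measure \<mu> R) f"
  by (metis less_le measure_pmf.variance_positive)

lemma spectral_gap_le:
  "spectral_gap p \<mu> R * (ip f f - (ip (\<lambda>_. 1) f)\<^sup>2) \<le> energy f"
proof (cases "measure_pmf.variance (restricted_measure \<mu> R) f = 0")
  \<comment> \<open>Such \<open>f\<close> are left out of the infimum, but for them the left-hand
    side is zero.\<close>
  case True
  then show ?thesis using energy_nonneg by (simp add: variance_eq)
next
  case False
  then have pos: "0 < measure_pmf.variance (restricted_measure \<mu> R) f"
    by (simp only: variance_pos_iff)
  have "spectral_gap p \<mu> R \<le> dirichlet_form p \<mu> R f / measure_pmf.variance (restricted_measure \<mu> R) f"
    unfolding spectral_gap_def
  proof (rule cInf_lower)
    show "bdd_below {dirichlet_form p \<mu> R f / measure_pmf.variance (restricted_measure \<mu> R) f | f.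
          measure_pmf.variance (restricted_measure \<mu> R) f \<noteq> 0}"
      by (intro bdd_belowI[of _ 0]) (auto simp: dirichlet_form_eq energy_nonneg measure_pmf.variance_positive)
  qed (use False in auto)
  then show ?thesis using pos by (simp add: dirichlet_form_eq variance_eq le_divide_eq)
qed

text \<open>A Poincare constant \<open>C\<close> bounds every quotient below by
  \<open>1 / C\<close>; the indicator of one of two states shows that the set of quotients is
  nonempty.\<close>

lemma spectral_gap_pos: "0 < spectral_gap p \<mu> R"
proof -
  obtain C where C: "0 < C" "\<And>f. ip f f - (ip (\<lambda>_. 1) f)\<^sup>2 \<le> C * energy f"
    using poincare by blast
  obtain x y where xy: "x \<in> R" "y \<in> R" "x \<noteq> y"
    using two_states card_2_iff' ex_card[of 2 R] by (metis subset_iff)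
  have "measure_pmf.variance (restricted_measure \<mu> R) (indicator {x} :: 'a \<Rightarrow> real) \<noteq> 0"
  proof -
    let ?m = "pmf (restricted_measure \<mu> R)"
    have "(\<Sum>z\<in>{x, y}. ?m z) \<le> (\<Sum>z\<in>R. ?m z)" using xy by (intro sum_mono2) auto
    then have "?m x < 1" using m_sum m_pos[OF xy(2)] xy(3) by simp
    moreover have "0 < ?m x" using xy(1) by (rule m_pos)
    moreover have "ip (\<lambda>_. 1) (indicator {x}) = ?m x" "ip (indicator {x}) (indicator {x}) = ?m x"
      using xy(1) by (simp_all add: ip_def indicator_def if_distrib[of "\<lambda>u. _ * u"] cong: if_cong)
    ultimately show ?thesis
      unfolding variance_eq by (simp add: power2_eq_square algebra_simps)
  qed
  then have "{dirichlet_form p \<mu> R f / measure_pmf.variance (restricted_measure \<mu> R) f | f.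
          measure_pmf.variance (restricted_measure \<mu> R) f \<noteq> 0} \<noteq> {}" by blast
  then have "1 / C \<le> spectral_gap p \<mu> R"
    unfolding spectral_gap_def
  proof (rule cInf_greatest)
    fix r assume "r \<in> {dirichlet_form p \<mu> R f / measure_pmf.variance (restricted_measure \<mu> R) f | f.
          measure_pmf.variance (restricted_measure \<mu> R) f \<noteq> 0}"
    then obtain f where r: "r = energy f / measure_pmf.variance (restricted_measure \<mu> R) f"
      and "0 < measure_pmf.variance (restricted_measure \<mu> R) f"
      using variance_pos_iff by (auto simp: dirichlet_form_eq)
    moreover have "1 / C \<le> e / v" if "0 < v" "v \<le> C * e" for e v :: real
      using that C(1) by (simp add: field_simps)
    ultimately show "1 / C \<le> r" using C(2) by (simp add: variance_eq)
  qed
  with C(1) show ?thesis by (metis less_le_trans zero_less_divide_1_iff)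
qed

section \<open>Identification of the spectral radius and of the quasi-stationary measure\<close>

lemma spectral_radius_eq:
  assumes h: "\<And>x. x \<in> R \<Longrightarrow> 0 < h x" and eig: "\<And>x. x \<in> R \<Longrightarrow> killed h x = l * h x" and l: "0 \<le> l"
  shows "spectral_radius_on R p = l"
  unfolding spectral_radius_on_def
proof (rule cSup_eq_maximum)
  obtain x where x: "x \<in> R" using m_sum by fastforce
  have "(\<Sum>y\<in>R. complex_of_real (p x y) * of_real (h y)) = of_real l * of_real (h x)" if "x \<in> R" for x
    using arg_cong[OF eig[OF that], of complex_of_real] by (simp add: killed_def)
  then show "l \<in> {cmod l |l. \<exists>f. (\<exists>x\<in>R. f x \<noteq> 0) \<and>
      (\<forall>x\<in>R. (\<Sum>y\<in>R. complex_of_real (p x y) * f y) = l * f x)}"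
    using l x h[OF x] by (intro CollectI exI[of _ "complex_of_real l"] conjI exI[of _ "of_real \<circ> h"]) force+
next
  fix r assume "r \<in> {cmod l |l. \<exists>f. (\<exists>x\<in>R. f x \<noteq> 0) \<and>
      (\<forall>x\<in>R. (\<Sum>y\<in>R. complex_of_real (p x y) * f y) = l * f x)}"
  then obtain c f x where r: "r = cmod c" and x: "x \<in> R" "f x \<noteq> 0"
    and f: "\<And>x. x \<in> R \<Longrightarrow> (\<Sum>y\<in>R. complex_of_real (p x y) * f y) = c * f x" by blast
  define a where "a x = cmod (f x)" for x
  \<comment> \<open>The modulus of a complex eigenvector is a subsolution; pairing it with the
    positive \<open>h\<close> then compares \<open>r\<close> with \<open>l\<close>.\<close>
  have sub: "r * a x \<le> killed a x" if "x \<in> R" for x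
  proof -
    have "r * a x = cmod (\<Sum>y\<in>R. complex_of_real (p x y) * f y)"
      by (simp add: f[OF that] r a_def norm_mult)
    also have "\<dots> \<le> killed a x"
      unfolding killed_def a_def
      by (intro norm_sum[THEN order_trans] sum_mono) (simp add: norm_mult p_nonneg)
    finally show ?thesis .
  qed
  have "r * ip h a = ip h (\<lambda>x. r * a x)" by (simp only: ip_scale)
  also have "\<dots> \<le> ip h (killed a)"
    unfolding ip_def using sub h m_nonneg
    by (intro sum_mono mult_left_mono) (auto simp: less_imp_le)
  also have "\<dots> = ip (\<lambda>x. l * h x) a"
    unfolding killed_selfadjoint by (intro ip_cong) (simp_all add: eig)
  finally have "r * ip h a \<le> l * ip h a" by (simp only: ip_scale')
  moreover have "0 < ip h a"
    unfolding ip_def using x h m_pos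
    by (intro sum_pos2[of R x]) (auto simp: a_def less_imp_le m_nonneg)
  ultimately show "r \<le> l" by simp
qed

text \<open>The candidate is \<open>m h\<close>. For uniqueness, the density \<open>u\<close> of any
  solution is an eigenvector for \<open>1 - \<phi>\<close>; its part orthogonal to \<open>h\<close>
  vanishes since \<open>\<phi> < g\<close>, and normalisation fixes the multiple of
  \<open>h\<close>.\<close>

lemma mu_star_eq:
  assumes qs: "quasi_stationary p (pmf (restricted_measure \<mu> R)) R h (phi_star p R) g"
    and y: "y \<in> R"
  shows "pmf (mu_star p R) y = pmf (restricted_measure \<mu> R) y * h y"
proof -
  let ?m = "pmf (restricted_measure \<mu> R)" and ?\<phi> = "phi_star p R"
  interpret quasi_stationary p ?m R h ?\<phi> g by (rule qs)
  define w where "w x = (if x \<in> R then ?m x * h x else 0)" for x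
  define \<nu> where "\<nu> = embed_pmf w"
  have w0: "0 \<le> w x" for x
    by (cases "x \<in> R") (use h_pos in \<open>auto simp: w_def less_imp_le\<close>)
  have "(\<Sum>x\<in>UNIV. w x) = 1"
    using h_mean by (simp add: w_def ip_def sum.If_cases)
  then have w\<nu>: "pmf \<nu> x = w x" for x
    unfolding \<nu>_def using w0
    by (intro pmf_embed_pmf) (simp_all add: nn_integral_count_space_finite)
  define stat where "stat \<nu>' \<longleftrightarrow> set_pmf \<nu>' \<subseteq> R \<and>
    (\<forall>y\<in>R. (\<Sum>x\<in>R. pmf \<nu>' x * p x y) = (1 - ?\<phi>) * pmf \<nu>' y)" for \<nu>'
  \<comment> \<open>Detailed balance turns the left action on measures into \<open>killed\<close> on
    densities with respect to \<open>m\<close>.\<close>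
  have eq: "(\<Sum>x\<in>R. pmf \<nu>' x * p x y) = ?m y * killed (\<lambda>x. pmf \<nu>' x / ?m x) y" if "y \<in> R" for \<nu>' y
  proof -
    have "pmf \<nu>' x * p x y = ?m y * (p y x * (pmf \<nu>' x / ?m x))" if "x \<in> R" for x
      using detailed_balance[OF \<open>y \<in> R\<close> that] m_pos[OF that] by (simp add: field_simps)
    then show ?thesis by (simp add: killed_def sum_distrib_left)
  qed
  have "stat \<nu>"
    unfolding stat_def
  proof (intro conjI ballI)
    show "set_pmf \<nu> \<subseteq> R" by (auto simp: set_pmf_iff w\<nu> w_def split: if_splits)
    fix y assume y: "y \<in> R"
    have "?m x \<noteq> 0" if "x \<in> R" for x using m_pos[OF that] by simp
    then have "killed (\<lambda>x. pmf \<nu> x / ?m x) = killed h"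
      by (intro killed_cong) (simp add: w\<nu> w_def)
    then have "(\<Sum>x\<in>R. pmf \<nu> x * p x y) = ?m y * killed h y" by (simp only: eq[OF y])
    with y show "(\<Sum>x\<in>R. pmf \<nu> x * p x y) = (1 - ?\<phi>) * pmf \<nu> y"
      by (simp add: h_eig w\<nu> w_def)
  qed
  moreover have "\<nu>' = \<nu>" if "stat \<nu>'" for \<nu>'
  proof -
    define u where "u x = pmf \<nu>' x / ?m x" for x
    have eig: "killed u x = (1 - ?\<phi>) * u x" if "x \<in> R" for x
    proof -
      have "?m x * killed u x = (\<Sum>z\<in>R. pmf \<nu>' z * p z x)"
        unfolding eq[OF that] u_def[abs_def] ..
      also have "\<dots> = (1 - ?\<phi>) * pmf \<nu>' x"
        using \<open>stat \<nu>'\<close> that by (simp add: stat_def)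
      finally show ?thesis using m_pos[OF that] by (simp add: u_def field_simps)
    qed
    define c where "c = ip h u / ip h h"
    define f where "f x = u x - c * h x" for x
    have "c * ip h h = ip h u" using norm_h_pos by (simp add: c_def)
    then have perp: "ip h f = 0" unfolding f_def by (simp add: ip_diff ip_scale)
    have "killed f x = (1 - ?\<phi>) * f x" if "x \<in> R" for x
      unfolding f_def[abs_def] by (simp add: killed_diff killed_scale eig h_eig that algebra_simps)
    then have "ip f (killed f) = ip f (\<lambda>x. (1 - ?\<phi>) * f x)" by (intro ip_cong) simp_all
    then have "ip f (killed f) = (1 - ?\<phi>) * ip f f" by (simp only: ip_scale)
    \<comment> \<open>On the complement of \<open>h\<close> the form of \<open>1 - killed\<close> is
      at least \<open>g\<close>, so eigenvalue \<open>1 - \<phi>\<close> forces \<open>f\<close> to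
      vanish on \<open>R\<close>.\<close>
    then have "(g - ?\<phi>) * ip f f \<le> 0"
      using perp_gap[OF perp] by (simp add: algebra_simps)
    then have "ip f f \<le> 0" using phi_less by (simp add: mult_le_0_iff)
    then have f0: "f x = 0" if "x \<in> R" for x using ip_pos[OF that, of f] by force
    have "ip (\<lambda>_. 1) u = c * ip (\<lambda>_. 1) h"
      unfolding ip_scale[symmetric] by (intro ip_cong) (use f0 in \<open>simp_all add: f_def\<close>)
    moreover have "ip (\<lambda>_. 1) u = (\<Sum>x\<in>R. pmf \<nu>' x)"
      unfolding ip_def by (intro sum.cong) (use m_pos in \<open>force simp: u_def\<close>)+
    moreover have "(\<Sum>x\<in>R. pmf \<nu>' x) = 1"
      using \<open>stat \<nu>'\<close> by (intro sum_pmf_eq_1) (auto simp: stat_def)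
    ultimately have "c = 1" by (simp add: h_mean)
    show "\<nu>' = \<nu>"
    proof (rule pmf_eqI)
      fix x
      show "pmf \<nu>' x = pmf \<nu> x"
      proof (cases "x \<in> R")
        case True
        with f0[OF True] m_pos[OF True] show ?thesis
          by (simp add: f_def u_def \<open>c = 1\<close> w\<nu> w_def field_simps)
      next
        case False
        then have "x \<notin> set_pmf \<nu>'" using \<open>stat \<nu>'\<close> by (auto simp: stat_def)
        with False show ?thesis by (simp add: w\<nu> w_def set_pmf_iff)
      qed
    qed
  qed
  ultimately have "mu_star p R = \<nu>"
    unfolding mu_star_def stat_def by (intro the_equality) blast+
  with y show ?thesis by (simp add: w\<nu> w_def)
qed

end

section \<open>Assembly of the bound for the process conditioned on survival\<close>

theorem theorem2p4:
  fixes p :: "'a::finite \<Rightarrow> 'a \<Rightarrow> real" and \<mu> :: "'a pmf" and R :: "'a set"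
    and P :: "'a \<Rightarrow> 'w measure" and X :: "real \<Rightarrow> 'w \<Rightarrow> 'a"
    and x y :: 'a and \<delta> t :: real
  assumes "stochastic_kernel p"
    and "reversible p \<mu>"
    and "irreducible_on UNIV p"
    and "markov_process p P X"
    and "R \<subset> UNIV" and "card R \<ge> 2"
    and "irreducible_on R (restricted_kernel p R)"
    and "irreducible_on (- R) (restricted_kernel p (- R))"
    and "eps_star p \<mu> R < 1 / 3"
    and "x \<in> R" and "y \<in> R"
    and "0 < \<delta>" and "\<delta> < 1"
    and "t > T_star p \<mu> R \<delta>"
  shows "\<bar>\<P>(\<omega> in P x. X t \<omega> = y \<bar> hitting_time X (- R) \<omega> > ereal t) / pmf (mu_star p R) y - 1\<bar> < \<delta>"
proof -
  note p = assms(1) and markov = assms(4) and x = assms(10) and y = assms(11) and \<delta> = assms(12,13)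
  let ?m = "pmf (restricted_measure \<mu> R)" and ?g = "spectral_gap p \<mu> R"
  let ?\<phi> = "phi_star p R" and ?\<epsilon> = "eps_star p \<mu> R" and ?\<zeta> = "zeta_star p \<mu> R"
  have pos: "0 < pmf \<mu> z" for z by (rule reversible_irreducible_pos) fact+
  interpret killed_kernel_pmf p \<mu> R
  proof (intro killed_kernel_pmf.intro killed_kernel_restricted_measure killed_kernel_pmf_axioms.intro)
    have "set_pmf \<mu> \<inter> R \<noteq> {}" using pos x by (auto simp: pmf_positive_iff)
    then show "set_pmf (restricted_measure \<mu> R) \<subseteq> R" by (simp add: set_cond_pmf)
  qed (use assms pos in auto)
  obtain h l where h: "\<And>x. x \<in> R \<Longrightarrow> 0 < h x" "ip (\<lambda>_. 1) h = 1"
    "\<And>x. x \<in> R \<Longrightarrow> killed h x = l * h x" "0 \<le> l" using perron_vector by blast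
  have l: "l = 1 - ?\<phi>" using spectral_radius_eq[OF h(1,3,4)] by (simp add: phi_star_def)
  have g: "0 < ?g" by (rule spectral_gap_pos)
  have \<phi>\<epsilon>: "?\<phi> = ?\<epsilon> * ?g" using g by (simp add: eps_star_def)
  \<comment> \<open>As \<open>?\<epsilon> < 1 / 3\<close>, the killing rate is below a third of the
    gap, and \<open>quasi_stationary\<close> applies.\<close>
  have "?\<phi> < ?g" using mult_strict_right_mono[OF assms(9) g] g by (simp add: \<phi>\<epsilon>)
  then have qs: "quasi_stationary p ?m R h ?\<phi> ?g"
    using h spectral_gap_le by unfold_locales (auto simp: l)
  then interpret quasi_stationary p ?m R h ?\<phi> ?g .
  have \<epsilon>0: "0 \<le> ?\<epsilon>" using phi_nonneg g by (simp add: eps_star_def)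
  have \<nu>: "pmf (mu_star p R) z = ?m z * h z" if "z \<in> R" for z
    using mu_star_eq[OF qs that] .
  have "h_star p \<mu> R z = h z" if "z \<in> R" for z
    using \<nu>[OF that] m_pos[OF that] by (simp add: h_star_def)
  then have \<zeta>_eq: "?\<zeta> = Min ((\<lambda>z. ?m z * (h z)\<^sup>2) ` R)"
    unfolding zeta_star_def by (intro arg_cong[where f = Min] image_cong) auto
  have \<zeta>_le: "?\<zeta> \<le> ?m z * (h z)\<^sup>2" if "z \<in> R" for z
    unfolding \<zeta>_eq using that by (intro Min_le) auto
  have "?\<zeta> \<in> (\<lambda>z. ?m z * (h z)\<^sup>2) ` R" unfolding \<zeta>_eq using x by (intro Min_in) auto
  then obtain z where "z \<in> R" "?\<zeta> = ?m z * (h z)\<^sup>2" by blast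
  then have \<zeta>_pos: "0 < ?\<zeta>" using m_pos[of z] h_pos[of z] by simp
  have \<zeta>n: "?\<zeta> \<le> ip h h" using \<zeta>_le[OF x] point_le_ip[OF x, of h] by linarith
  have n: "(1 - ?\<epsilon>) * ip h h \<le> 1"
    using norm_h_le g \<phi>\<epsilon> by (simp add: algebra_simps)
      (metis (no_types, lifting) mult.commute mult.left_commute mult_le_cancel_left_pos mult_1 distrib_left)
  note T = mixing_time_sufficient[OF g \<epsilon>0 assms(9) \<delta> n \<zeta>_pos \<zeta>n assms(14)[unfolded T_star_def]]
  define Q where "Q z = \<P>(\<omega> in P x. X t \<omega> = z \<and> hitting_time X (- R) \<omega> > ereal t)" for z
  interpret P: prob_space "P x" using markov by (rule process_prob_space)
  have [measurable]: "X t \<in> measurable (P x) (count_space UNIV)"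
    using markov T(1) by (intro process_measurable) auto
  define E where "E = {\<omega> \<in> space (P x). hitting_time X (- R) \<omega> > ereal t}"
  have [measurable]: "E \<in> sets (P x)"
    unfolding E_def using markov T(1) by (rule survival_event_measurable)
  \<comment> \<open>Survival beyond \<open>t\<close> implies \<open>X t \<omega> \<in> R\<close>, so
    \<open>sum Q R\<close> is the survival probability, the denominator of the conditional
    probability.\<close>
  have "sum Q R = (\<Sum>z\<in>R. P.prob {\<omega> \<in> E. X t \<omega> = z})"
    unfolding Q_def E_def by (intro sum.cong arg_cong[where f = P.prob]) auto
  also have "\<dots> = P.prob (\<Union>z\<in>R. {\<omega> \<in> E. X t \<omega> = z})"
    by (intro P.finite_measure_finite_Union[symmetric]) (auto simp: disjoint_family_on_def)
  also have "(\<Union>z\<in>R. {\<omega> \<in> E. X t \<omega> = z}) = E"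
  proof -
    have "X t \<omega> \<in> R" if "\<omega> \<in> E" for \<omega>
    proof -
      have "\<forall>n. \<forall>k\<le>2 ^ n. X (real k * (t / 2 ^ n)) \<omega> \<in> R"
        using that hitting_time_gt_iff[OF markov _ T(1)] unfolding E_def by blast
      from this[rule_format, of 1 0] show ?thesis by simp
    qed
    then show ?thesis by blast
  qed
  finally have cond: "\<P>(\<omega> in P x. X t \<omega> = y \<bar> hitting_time X (- R) \<omega> > ereal t) = Q y / sum Q R"
    by (simp add: cond_prob_def Q_def E_def)
  \<comment> \<open>The factor \<open>exp (- ?\<phi> * t) * h x / ip h h\<close>, common to all
    \<open>z\<close>, is taken as \<open>W\<close> and cancels under conditioning.\<close>
  have "\<bar>Q y / sum Q R / (?m y * h y) - 1\<bar> < \<delta>"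
  proof (rule ratio_close_if_relative_error[where \<nu> = "\<lambda>z. ?m z * h z"])
    show "(\<Sum>z\<in>R. ?m z * h z) = 1" using h_mean by (simp add: ip_def)
    show "0 < exp (- ?\<phi> * t) * h x / ip h h" using h_pos[OF x] norm_h_pos by simp
    \<comment> \<open>The rates agree because
      \<open>(1 - ?\<epsilon>) * ?g = ?g - ?\<phi>\<close>.\<close>
    show "exp (- (?g - ?\<phi>) * t) * ip h h / ?\<zeta> < \<delta> * (1 - \<delta>) / 2"
      using T(2) by (simp add: \<phi>\<epsilon> algebra_simps)
    show "\<bar>Q z - exp (- ?\<phi> * t) * h x / ip h h * (?m z * h z)\<bar>
      \<le> exp (- (?g - ?\<phi>) * t) * ip h h / ?\<zeta> * (exp (- ?\<phi> * t) * h x / ip h h * (?m z * h z))"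
      if "z \<in> R" for z
      unfolding Q_def
      by (rule relative_error[OF x that T(1) \<zeta>_pos \<zeta>_le killed_prob_limit[OF markov killed_kernel_axioms p T(1) x]])
  qed (use y \<delta> m_pos h_pos in auto)
  then show ?thesis by (simp add: cond \<nu>[OF y])
qed

end
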